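(* For every $n \ge 1$, the polynomial $f^+_n(x)$ is equal to the local $h$-polynomial $\ell_{[n]}(K_n, x)$ of the simplicial subdivision $K_n$ of the simplex $2^{[n]}$. In particular, $f^+_n$ has nonnegative, symmetric and unimodal coefficients. Moreover, for every $n \in \mathbb{N}$, $$ f^+_n(x) = \sum_{k=0}^n (-1)^{n-k} \binom{n}{k} B^+_k(x) \quad\text{and}\quad f^-_n(x) = \sum_{k=0}^n (-1)^{n-k} \binom{n}{k} B^-_k(x). $$
   Context: Signed permutations: a signed permutation of $[n]$ is a set $S = \{a_1, \dots, a_n\}$ with $a_i \in \{i, -i\}$, together with a bijection $w : S \to S$, written as the word $w(a_1) \cdots w(a_n)$. The set of these is $B_n$. - An index $i \in \{0, \dots, n-1\}$ is a $B$-descent if $w(a_i) > w(a_{i+1})$, with the convention $w(a_0) = 0$; $\mathrm{des}_B(w)$ is the number of $B$-descents. - $B^+_n$ (resp. $B^-_n$) is the set of $w \in B_n$ with $w(a_n) > 0$ (resp. $< 0$). - $B^\pm_n(x) = \sum_{w \in B^\pm_n} x^{\mathrm{des}_B(w)}$, with $B^+_0(x) = 1$ and $B^-_0(x) = 0$. - $a \in S$ is a $B$-excedance if $w(a) > a$, or if $a < 0$ and $w(a) = a$. - $w$ is a derangement if no $a \in S$ with $a > 0$ satisfies $w(a) = a$. - $d^B_n(x) = \sum_{w \text{ derangement}} x^{\mathrm{exc}_B(w)}$, with $d^B_0 = 1$. - $f^+_n, f^-_n$ are the unique real polynomials with $d^B_n = f^+_n + f^-_n$, $f^+_n(x) = x^n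 f^+_n(1/x)$ and $f^-_n(x) = x^{n+1} f^-_n(1/x)$. Face enumeration: for a simplicial complex $\Delta$ of dimension $d-1$, the $h$-polynomial is $h(\Delta, x) = \sum_{F \in \Delta} x^{|F|} (1-x)^{d-|F|}$. Subdivisions: a simplicial subdivision of the simplex $2^V$ (with $|V| = d$) is a simplicial complex $\Gamma$ with a map $\sigma : \Gamma \to 2^V$ such that, for every $F \subseteq V$, the restriction $\Gamma_F = \sigma^{-1}(2^F)$ is a subcomplex homeomorphic to a ball of dimension $|F|-1$ whose interior is $\sigma^{-1}(F)$. Its local $h$-polynomial is $$ \ell_V(\Gamma, x) = \sum_{F \subseteq V} (-1)^{d-|F|}\, h(\Gamma_F, x). $$ $K_n$: let $P$ be the set of intervals $[A, B]$ with $\emptyset \ne A \subseteq B \subseteq [n]$ (intervals in the Boolean lattice), ordered by inclusion: $[A, B] \le [A', B']$ iff $A' \subseteq A$ and $B \subseteq B'$. $K_n$ is the order complex of $P$, i.e. the simplicial complex of chains of $P$. It is a simplicial subdivision of $2^{[n]}$ via the carrier map sending a nonempty chain to the set $B$ of its largest element $[A, B]$, and the empty chain to $\emptyset$. *)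

theory Defs
  imports "HOL-Computational_Algebra.Polynomial"
begin

text \<open>A signed permutation of [n] is a pair (S, w): S = {a_1,...,a_n} with a_i in {i,-i},
  and w a bijection S -> S (normalised to be the identity outside S).\<close>

definition signed_perms :: "nat \<Rightarrow> (int set \<times> (int \<Rightarrow> int)) set" where
  "signed_perms n = {(S, w).
     (\<exists>a :: nat \<Rightarrow> int. (\<forall>i\<in>{1..n}. a i = int i \<or> a i = - int i) \<and> S = a ` {1..n}) \<and>
     bij_betw w S S \<and> (\<forall>x. x \<notin> S \<longrightarrow> w x = x)}"

definition sa :: "int set \<Rightarrow> nat \<Rightarrow> int" where
  "sa S i = (if int i \<in> S then int i else - int i)"

definition wval :: "int set \<Rightarrow> (int \<Rightarrow> int) \<Rightarrow> nat \<Rightarrow> int" where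
  "wval S w i = (if i = 0 then 0 else w (sa S i))"

definition desB :: "nat \<Rightarrow> int set \<Rightarrow> (int \<Rightarrow> int) \<Rightarrow> nat" where
  "desB n S w = card {i \<in> {0..<n}. wval S w i > wval S w (Suc i)}"

definition Bplus :: "nat \<Rightarrow> real poly" where
  "Bplus n = (if n = 0 then 1 else
     (\<Sum>p\<in>{p \<in> signed_perms n. snd p (sa (fst p) n) > 0}. monom 1 (desB n (fst p) (snd p))))"

definition Bminus :: "nat \<Rightarrow> real poly" where
  "Bminus n = (if n = 0 then 0 else
     (\<Sum>p\<in>{p \<in> signed_perms n. snd p (sa (fst p) n) < 0}. monom 1 (desB n (fst p) (snd p))))"

definition excB :: "int set \<Rightarrow> (int \<Rightarrow> int) \<Rightarrow> nat" where
  "excB S w = card {a \<in> S. w a > a \<or> (a < 0 \<and> w a = a)}"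

definition is_derangement :: "int set \<Rightarrow> (int \<Rightarrow> int) \<Rightarrow> bool" where
  "is_derangement S w \<longleftrightarrow> (\<forall>a\<in>S. a > 0 \<longrightarrow> w a \<noteq> a)"

definition dB :: "nat \<Rightarrow> real poly" where
  "dB n = (if n = 0 then 1 else
     (\<Sum>p\<in>{p \<in> signed_perms n. is_derangement (fst p) (snd p)}. monom 1 (excB (fst p) (snd p))))"

definition fpm_decomp :: "nat \<Rightarrow> real poly \<Rightarrow> real poly \<Rightarrow> bool" where
  "fpm_decomp n fp fm \<longleftrightarrow> dB n = fp + fm \<and>
     (\<forall>x::real. x \<noteq> 0 \<longrightarrow> poly fp x = x ^ n * poly fp (1 / x)) \<and>
     (\<forall>x::real. x \<noteq> 0 \<longrightarrow> poly fm x = x ^ (n + 1) * poly fm (1 / x))"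

definition fplus :: "nat \<Rightarrow> real poly" where
  "fplus n = fst (THE pq. fpm_decomp n (fst pq) (snd pq))"

definition fminus :: "nat \<Rightarrow> real poly" where
  "fminus n = snd (THE pq. fpm_decomp n (fst pq) (snd pq))"

text \<open>h-polynomial of a simplicial complex (given as its set of faces, including the empty face);
  d = dim + 1 = maximal face size.\<close>
definition h_poly :: "'a set set \<Rightarrow> real poly" where
  "h_poly \<Delta> = (let d = Max (card ` \<Delta>) in
     (\<Sum>F\<in>\<Delta>. monom 1 (card F) * [:1, -1:] ^ (d - card F)))"

definition local_h :: "'b set \<Rightarrow> 'a set set \<Rightarrow> ('a set \<Rightarrow> 'b set) \<Rightarrow> real poly" where
  "local_h V \<Gamma> \<sigma> = (\<Sum>F\<in>Pow V. smult ((-1) ^ (card V - card F)) (h_poly {G \<in> \<Gamma>. \<sigma> G \<subseteq> F}))"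

definition intervals :: "nat \<Rightarrow> (nat set \<times> nat set) set" where
  "intervals n = {(A, B). A \<noteq> {} \<and> A \<subseteq> B \<and> B \<subseteq> {1..n}}"

definition int_le :: "nat set \<times> nat set \<Rightarrow> nat set \<times> nat set \<Rightarrow> bool" where
  "int_le p q \<longleftrightarrow> fst q \<subseteq> fst p \<and> snd p \<subseteq> snd q"

definition K :: "nat \<Rightarrow> (nat set \<times> nat set) set set" where
  "K n = {c. c \<subseteq> intervals n \<and> (\<forall>p\<in>c. \<forall>q\<in>c. int_le p q \<or> int_le q p)}"

definition K_carrier :: "(nat set \<times> nat set) set \<Rightarrow> nat set" where
  "K_carrier c = (if c = {} then {} else snd (THE m. m \<in> c \<and> (\<forall>p\<in>c. int_le p m)))"

definition unimodal_upto :: "real poly \<Rightarrow> nat \<Rightarrow> bool" where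
  "unimodal_upto p n \<longleftrightarrow> (\<exists>k\<le>n. (\<forall>i<k. coeff p i \<le> coeff p (Suc i)) \<and>
                                  (\<forall>i. k \<le> i \<and> i < n \<longrightarrow> coeff p (Suc i) \<le> coeff p i))"

end

theory Submission
  imports Defs "HOL-Combinatorics.Multiset_Permutations"
    "HOL-Computational_Algebra.Polynomial_FPS"
begin

text \<open>
  Inserting the letters \<open>n + 1\<close> and \<open>- (n + 1)\<close> into a signed permutation changes descents in a word
  and excedances in a cycle decomposition in the same way. The resulting recursion gives
  \<open>B\<^sub>n(x) / (1 - x)\<^bsup>n + 1\<^esup> = \<Sum>\<^sub>m (2m + 1)\<^sup>n x\<^sup>m\<close> for \<open>B\<^sub>n = B\<^sup>+\<^sub>n + B\<^sup>-\<^sub>n\<close>, shows that \<open>B\<^sub>n\<close> is also the excedance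
  polynomial, and gives \<open>B\<^sup>+\<^sub>n(x) / (1 - x)\<^sup>n = \<Sum>\<^sub>m ((2m + 1)\<^sup>n - (2m)\<^sup>n) x\<^sup>m\<close>. Expanding
  \<open>2m + 1 = 2 + (2(m - 1) + 1)\<close> by the binomial theorem turns these series into recursions for \<open>B\<^sub>n\<close>
  and \<open>B\<^sup>+\<^sub>n\<close>, and sorting the chains of \<open>K\<^sub>n\<close> by their largest interval gives the same recursions.
  Hence the restriction of \<open>K\<^sub>n\<close> to \<open>F\<close> has h-polynomial \<open>B\<^sup>+\<close> with index \<open>card F\<close>, and the local
  h-polynomial is the binomial transform \<open>P\<^sub>n\<close> of \<open>B\<^sup>+\<close>. By Moebius inversion over the set of letters
  that are not positive fixed points, \<open>d\<^sub>n = P\<^sub>n + M\<^sub>n\<close> with \<open>M\<^sub>n\<close> the binomial transform of \<open>B\<^sup>-\<close>.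

  The exponential generating functions of \<open>P\<close> and \<open>M\<close> are
  \<open>(e\<^bsup>xt\<^esup> - x e\<^sup>t) / (e\<^bsup>2xt\<^esup> - x e\<^bsup>2t\<^esup>)\<close> and \<open>x (e\<^sup>t - e\<^bsup>xt\<^esup>) / (e\<^bsup>2xt\<^esup> - x e\<^bsup>2t\<^esup>)\<close>. Dividing numerator and
  denominator by \<open>1 - x\<close> yields recursions with the coefficients \<open>x + \<dots> + x\<^bsup>k - 1\<^esup>\<close>, from which the
  symmetry of \<open>P\<^sub>n\<close> and \<open>M\<^sub>n\<close> and the nonnegativity and unimodality of \<open>P\<^sub>n\<close> follow by induction.
\<close>

section \<open>Binomial convolutions\<close>

definition binomial_conv :: "(nat \<Rightarrow> 'a) \<Rightarrow> (nat \<Rightarrow> 'a) \<Rightarrow> nat \<Rightarrow> 'a::comm_semiring_1" where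
  "binomial_conv a b n = (\<Sum>k\<le>n. of_nat (n choose k) * a (n - k) * b k)"

lemma sum_Pow_eq_binomial_conv:
  assumes "finite N"
  shows "(\<Sum>M\<in>Pow N. a (card N - card M) * b (card M)) = binomial_conv a b (card N)"
proof -
  let ?f = "\<lambda>k. a (card N - k) * b k"
  have "(\<Sum>M\<in>Pow N. ?f (card M)) = (\<Sum>k\<le>card N. \<Sum>M\<in>{M \<in> Pow N. card M = k}. ?f (card M))"
    using assms by (intro sum.group [symmetric]) (auto simp: card_mono)
  also have "\<dots> = (\<Sum>k\<le>card N. of_nat (card {M. M \<subseteq> N \<and> card M = k}) * ?f k)"
    by (intro sum.cong) auto
  finally show ?thesis
    using assms by (simp add: n_subsets binomial_conv_def mult.assoc)
qed

lemma power_mult_binomial_conv: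
  "c ^ n * binomial_conv a b n = binomial_conv (\<lambda>k. c ^ k * a k) (\<lambda>k. c ^ k * b k) n"
  unfolding binomial_conv_def sum_distrib_left
proof (rule sum.cong[OF refl])
  fix k assume "k \<in> {..n}"
  then have "c ^ n = c ^ (n - k) * c ^ k" by (simp flip: power_add)
  then show "c ^ n * (of_nat (n choose k) * a (n - k) * b k) =
      of_nat (n choose k) * (c ^ (n - k) * a (n - k)) * (c ^ k * b k)"
    by (simp only: mult_ac)
qed

lemma divide_power_binomial_conv:
  fixes u :: "'a::field"
  assumes "u \<noteq> 0"
  shows "binomial_conv (\<lambda>k. u ^ k * c k) b n / u ^ n = binomial_conv c (\<lambda>k. b k / u ^ k) n"
  using power_mult_binomial_conv[of u n c "\<lambda>k. b k / u ^ k"] assms by (simp add: field_simps)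

lemma mult_binomial_conv_right: "c * binomial_conv a b n = binomial_conv a (\<lambda>k. c * b k) n"
  by (simp add: binomial_conv_def sum_distrib_left mult_ac)

lemma binomial_conv_powers: "binomial_conv (\<lambda>k. x ^ k) (\<lambda>k. y ^ k) n = (x + y) ^ n"
  unfolding binomial_conv_def add.commute[of x y] binomial_ring by (simp add: mult_ac)

lemma binomial_conv_add_right:
  "binomial_conv a (\<lambda>k. b k + c k) n = binomial_conv a b n + binomial_conv a c n"
  by (simp add: binomial_conv_def distrib_left sum.distrib)

lemma binomial_conv_diff_left:
  fixes a b c :: "nat \<Rightarrow> 'a::comm_ring_1"
  shows "binomial_conv (\<lambda>k. a k - b k) c n = binomial_conv a c n - binomial_conv b c n"
  by (simp add: binomial_conv_def algebra_simps sum_subtractf)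

lemma mult_binomial_conv_left: "c * binomial_conv a b n = binomial_conv (\<lambda>k. c * a k) b n"
  by (simp add: binomial_conv_def sum_distrib_left mult_ac)

lemma binomial_conv_delta_left: "binomial_conv (\<lambda>k. of_bool (k = 0)) b n = b n"
proof -
  have "binomial_conv (\<lambda>k. of_bool (k = 0)) b n = (\<Sum>k\<le>n. if k = n then b k else 0)"
    unfolding binomial_conv_def by (intro sum.cong) auto
  then show ?thesis by simp
qed

definition binomial_transform :: "(nat \<Rightarrow> 'a) \<Rightarrow> nat \<Rightarrow> 'a::comm_ring_1" where
  "binomial_transform f = binomial_conv (\<lambda>k. (- 1) ^ k) f"

lemma binomial_transform_eq_sum_smult:
  fixes f :: "nat \<Rightarrow> real poly"
  shows "binomial_transform f n = (\<Sum>k=0..n. smult ((- 1) ^ (n - k) * real (n choose k)) (f k))"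
  unfolding binomial_transform_def binomial_conv_def atMost_atLeast0
  by (intro sum.cong refl) (simp add: of_nat_poly minus_one_power_iff)

section \<open>Polynomials and their formal power series\<close>

lemma poly_eqI_cofinite:
  fixes p q :: "'a::{idom, ring_char_0} poly"
  assumes "finite A" "\<And>x. x \<notin> A \<Longrightarrow> poly p x = poly q x"
  shows "p = q"
proof (rule ccontr)
  assume "p \<noteq> q"
  then have "finite {x. poly (p - q) x = 0}" by (intro poly_roots_finite) simp
  moreover have "- A \<subseteq> {x. poly (p - q) x = 0}" using assms(2) by auto
  ultimately have "finite (- A)" by (rule rev_finite_subset)
  then show False using assms(1) infinite_UNIV_char_0[where ?'a = 'a] by (simp add: finite_compl)
qed

lemma poly_binomial_conv:
  "poly (binomial_conv a b n) x = binomial_conv (\<lambda>k. poly (a k) x) (\<lambda>k. poly (b k) x) n"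
  by (simp add: binomial_conv_def poly_sum)

lemma poly_binomial_transform:
  "poly (binomial_transform f n) x = binomial_transform (\<lambda>k. poly (f k) x) n"
  by (simp add: binomial_transform_def poly_binomial_conv)

lemma fps_of_poly_of_nat: "fps_of_poly (of_nat k :: 'a::comm_ring_1 poly) = of_nat k"
  by (simp add: of_nat_poly fps_of_poly_const fps_of_nat)

lemma fps_of_poly_binomial_conv:
  fixes a b :: "nat \<Rightarrow> 'a::comm_ring_1 poly"
  shows "fps_of_poly (binomial_conv a b n) =
    binomial_conv (\<lambda>k. fps_of_poly (a k)) (\<lambda>k. fps_of_poly (b k)) n"
  by (simp add: binomial_conv_def fps_of_poly_sum fps_of_poly_mult fps_of_poly_of_nat)

lemma fps_of_poly_one_minus_X: "fps_of_poly [:1, -1 :: 'a::comm_ring_1:] = 1 - fps_X"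
  by (simp add: fps_of_poly_pCons)

section \<open>Signed sets\<close>

abbreviation nat_abs :: "int \<Rightarrow> nat" where
  "nat_abs s \<equiv> nat \<bar>s\<bar>"

definition signed_sets :: "nat set \<Rightarrow> int set set" where
  "signed_sets N = {S. nat_abs ` S = N \<and> inj_on nat_abs S}"

lemma signed_sets_empty: "signed_sets {} = {{}}"
  by (auto simp: signed_sets_def)

lemma signed_sets_card: "S \<in> signed_sets N \<Longrightarrow> card S = card N"
  by (auto simp: signed_sets_def card_image)

lemma signed_sets_finite: "finite N \<Longrightarrow> S \<in> signed_sets N \<Longrightarrow> finite S"
  by (auto simp: signed_sets_def dest: finite_imageD)

lemma signed_sets_nat_abs: "S \<in> signed_sets N \<Longrightarrow> s \<in> S \<Longrightarrow> nat_abs s \<in> N"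
  by (auto simp: signed_sets_def)

lemma finite_signed_sets:
  assumes "finite N" shows "finite (signed_sets N)"
proof (rule finite_subset)
  show "signed_sets N \<subseteq> Pow (int ` N \<union> (\<lambda>k. - int k) ` N)"
  proof (intro subsetI PowI)
    fix S s assume "S \<in> signed_sets N" "s \<in> S"
    then have "nat_abs s \<in> N" by (rule signed_sets_nat_abs)
    moreover have "s = int (nat_abs s) \<or> s = - int (nat_abs s)" by linarith
    ultimately show "s \<in> int ` N \<union> (\<lambda>k. - int k) ` N" by blast
  qed
qed (use assms in auto)

lemma signed_sets_insert:
  assumes "m \<notin> N"
  shows "signed_sets (insert m N) =
    insert (int m) ` signed_sets N \<union> insert (- int m) ` signed_sets N"
proof (intro equalityI subsetI)
  fix S assume "S \<in> signed_sets (insert m N)"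
  then have S: "nat_abs ` S = insert m N" "inj_on nat_abs S"
    by (auto simp: signed_sets_def)
  then obtain s where s: "s \<in> S" "nat_abs s = m" by (metis imageE insertI1)
  then have "nat_abs ` (S - {s}) = N"
    using S assms by (auto simp: inj_on_image_set_diff[of _ S])
  then have "S - {s} \<in> signed_sets N"
    using S by (auto simp: signed_sets_def inj_on_diff)
  moreover have "S = insert s (S - {s})" "s = int m \<or> s = - int m" using s by auto
  ultimately show "S \<in> insert (int m) ` signed_sets N \<union> insert (- int m) ` signed_sets N" by blast
next
  fix S assume "S \<in> insert (int m) ` signed_sets N \<union> insert (- int m) ` signed_sets N"
  then show "S \<in> signed_sets (insert m N)"
    using assms by (auto simp: signed_sets_def)
qed

lemma sum_signed_sets_insert:
  assumes "finite N" "m > 0" "m \<notin> N"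
  shows "(\<Sum>S\<in>signed_sets (insert m N). f S) =
         (\<Sum>S\<in>signed_sets N. f (insert (int m) S) + f (insert (- int m) S))"
proof -
  have notin: "int m \<notin> S" "- int m \<notin> S" if "S \<in> signed_sets N" for S
    using signed_sets_nat_abs[OF that] assms(3) by fastforce+
  have inj: "inj_on (insert (int m)) (signed_sets N)" "inj_on (insert (- int m)) (signed_sets N)"
    using notin by (meson inj_onI insert_ident)+
  have "insert (int m) S \<noteq> insert (- int m) S'" if "S' \<in> signed_sets N" for S S'
    using notin(1)[OF that] assms(2)
    by (metis insert_iff of_nat_0_less_iff equal_neg_zero less_irrefl)
  then have "insert (int m) ` signed_sets N \<inter> insert (- int m) ` signed_sets N = {}"
    by blast
  then show ?thesis
    unfolding signed_sets_insert[OF assms(3)] using finite_signed_sets[OF assms(1)]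
    by (simp add: sum.union_disjoint sum.reindex[OF inj(1)] sum.reindex[OF inj(2)] sum.distrib)
qed

section \<open>Insertion of an extreme letter\<close>

text \<open>Descents and excedances behave alike: if there are \<open>d\<close> of them among \<open>n\<close> letters, then an
  extreme letter can be inserted in \<open>d\<close> places without changing their number and in \<open>n - d\<close> places
  where it adds one. The remaining place, the end of the word or a new fixed point, is treated
  separately.\<close>

definition insertion_step :: "nat \<Rightarrow> real poly \<Rightarrow> real poly" where
  "insertion_step n p = [:0, real n:] * p + [:0, 1, -1:] * pderiv p"

lemma insertion_step_power:
  "insertion_step n ([:0, 1:] ^ d) =
    of_nat d * [:0, 1:] ^ d + (of_nat n - of_nat d) * [:0, 1:] ^ Suc d"
proof (rule poly_ext)
  fix x
  have "pderiv ([:0, 1 :: real:] ^ d) = smult (of_nat d) ([:0, 1:] ^ (d - 1))"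
    by (simp add: pderiv_power pderiv_pCons)
  then show "poly (insertion_step n ([:0, 1:] ^ d)) x =
      poly (of_nat d * [:0, 1:] ^ d + (of_nat n - of_nat d) * [:0, 1:] ^ Suc d) x"
    unfolding insertion_step_def by (cases d) (simp_all add: algebra_simps)
qed

lemma insertion_step_0 [simp]: "insertion_step n 0 = 0"
  by (simp add: insertion_step_def)

lemma insertion_step_add: "insertion_step n (p + q) = insertion_step n p + insertion_step n q"
  by (simp add: insertion_step_def pderiv_add ring_distribs)

lemma insertion_step_sum: "insertion_step n (\<Sum>i\<in>A. f i) = (\<Sum>i\<in>A. insertion_step n (f i))"
  by (induction A rule: infinite_finite_induct) (simp_all add: insertion_step_add)

definition extreme :: "int \<Rightarrow> int set \<Rightarrow> bool" where
  "extreme a S \<longleftrightarrow> (\<forall>s\<in>insert 0 S. \<bar>s\<bar> < \<bar>a\<bar>)"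

lemma extremeD: "extreme a S \<Longrightarrow> s \<in> insert 0 S \<Longrightarrow> \<bar>s\<bar> < \<bar>a\<bar>"
  unfolding extreme_def by blast

lemma extreme_not_in: "extreme a S \<Longrightarrow> a \<notin> S"
  by (auto simp: extreme_def)

lemma extreme_signed_sets:
  assumes "S \<in> signed_sets N" "m > 0" "\<And>i. i \<in> N \<Longrightarrow> i < m"
  shows "extreme (int m) S" "extreme (- int m) S"
  using signed_sets_nat_abs[OF assms(1)] assms(2,3) by (fastforce simp: extreme_def)+

subsection \<open>Descents\<close>

fun des_from :: "'a::linorder \<Rightarrow> 'a list \<Rightarrow> nat" where
  "des_from b [] = 0"
| "des_from b (c # l) = of_bool (c < b) + des_from c l"

lemma des_from_snoc: "des_from b (l @ [a]) = des_from b l + of_bool (a < last (b # l))"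
  by (induction l arbitrary: b) auto

lemma sum_power_des_from_insert:
  fixes x :: "'b::comm_ring_1"
  assumes "(\<forall>c\<in>set (b # l). c < a) \<or> (\<forall>c\<in>set (b # l). a < c)"
  shows "(\<Sum>i<length l. x ^ des_from b (take i l @ a # drop i l)) =
    of_nat (des_from b l) * x ^ des_from b l +
    (of_nat (length l) - of_nat (des_from b l)) * x ^ Suc (des_from b l)"
  using assms
proof (induction l arbitrary: b)
  case (Cons c l)
  have "(\<Sum>i<length (c # l). x ^ des_from b (take i (c # l) @ a # drop i (c # l))) =
      x ^ des_from b (a # c # l) +
      x ^ of_bool (c < b) * (\<Sum>i<length l. x ^ des_from c (take i l @ a # drop i l))"
    by (simp only: length_Cons sum.lessThan_Suc_shift)
       (simp add: power_add sum_distrib_left del: sum.lessThan_Suc)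
  also have "(\<Sum>i<length l. x ^ des_from c (take i l @ a # drop i l)) =
      of_nat (des_from c l) * x ^ des_from c l +
      (of_nat (length l) - of_nat (des_from c l)) * x ^ Suc (des_from c l)"
    using Cons.prems by (intro Cons.IH) auto
  moreover have "des_from b (a # c # l) = Suc (des_from c l)" using Cons.prems by auto
  ultimately show ?case
    by (cases "c < b") (simp_all add: algebra_simps)
qed simp

lemma permutations_of_set_insert_split:
  assumes "l \<in> permutations_of_set (insert a S)" "a \<notin> S"
  obtains u v where "l = u @ a # v" "a \<notin> set u" "u @ v \<in> permutations_of_set S"
proof -
  obtain u v where l: "l = u @ a # v" "a \<notin> set u"
    using assms(1) by (metis insertI1 permutations_of_setD(1) split_list_first)
  moreover have "distinct (u @ a # v)" "set (u @ a # v) = insert a S"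
    using assms(1) l(1) by (auto simp: permutations_of_set_def)
  then have "u @ v \<in> permutations_of_set S"
    using assms(2) by (auto simp: permutations_of_set_def)
  ultimately show ?thesis using that by blast
qed

lemma sum_permutations_of_set_insert:
  assumes "a \<notin> S"
  shows "(\<Sum>l\<in>permutations_of_set (insert a S). f l) =
    (\<Sum>l\<in>permutations_of_set S. \<Sum>i\<le>length l. f (take i l @ a # drop i l))"
proof -
  have "(\<Sum>l\<in>permutations_of_set (insert a S). f l) =
    (\<Sum>(l, i)\<in>(SIGMA l:permutations_of_set S. {..length l}). f (take i l @ a # drop i l))"
  proof (rule sum.reindex_bij_witness[where
        i = "\<lambda>(l, i). take i l @ a # drop i l" and
        j = "\<lambda>l. (remove1 a l, length (takeWhile (\<lambda>b. b \<noteq> a) l))"], goal_cases)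
    case (1 l)
    then show ?case using assms
      by (elim permutations_of_set_insert_split) (simp_all add: remove1_append takeWhile_append)
  next
    case (2 l)
    then show ?case using assms
      by (elim permutations_of_set_insert_split) (simp_all add: remove1_append takeWhile_append)
  next
    case (3 li)
    then obtain l i where li: "li = (l, i)" "set l = S" "distinct l" "i \<le> length l"
      by (auto simp: permutations_of_set_def)
    then have "a \<notin> set (take i l)" using assms set_take_subset by fastforce
    then show ?case using li by (simp add: remove1_append takeWhile_append)
  next
    case (4 li)
    then obtain l i where li: "li = (l, i)" "set l = S" "distinct l"
      by (auto simp: permutations_of_set_def)
    have "set (take i l) \<union> set (drop i l) = S" "distinct (take i l @ drop i l)"
      using li by (simp_all flip: set_append)
    then show ?case using li assms
      by (auto simp: permutations_of_set_def simp del: append_take_drop_id)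
  next
    case (5 l)
    then show ?case using assms
      by (elim permutations_of_set_insert_split) (simp_all add: remove1_append takeWhile_append)
  qed
  then show ?thesis by (simp add: sum.Sigma)
qed

text \<open>Prepending \<open>1\<close> makes the empty word end in a positive letter, in accordance with
  \<open>B\<^sup>+\<^sub>0 = 1\<close> and \<open>B\<^sup>-\<^sub>0 = 0\<close>.\<close>

definition des_weight :: "(int \<Rightarrow> bool) \<Rightarrow> int list \<Rightarrow> real poly" where
  "des_weight P l = (if P (last (1 # l)) then [:0, 1:] ^ des_from 0 l else 0)"

definition des_poly :: "(int \<Rightarrow> bool) \<Rightarrow> int set \<Rightarrow> real poly" where
  "des_poly P S = (\<Sum>l\<in>permutations_of_set S. des_weight P l)"

lemma sum_des_weight_insert:
  assumes "extreme a (set l)"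
  shows "(\<Sum>i\<le>length l. des_weight P (take i l @ a # drop i l)) =
    insertion_step (length l) (des_weight P l) +
    (if P a then [:0, 1:] ^ of_bool (a < 0) * des_weight (\<lambda>_. True) l else 0)"
proof -
  have "(\<Sum>i<length l. des_weight P (take i l @ a # drop i l)) =
      (\<Sum>i<length l. if P (last (1 # l)) then [:0, 1:] ^ des_from 0 (take i l @ a # drop i l) else 0)"
  proof (rule sum.cong[OF refl])
    fix i assume "i \<in> {..<length l}"
    then have "last (1 # take i l @ a # drop i l) = last (1 # l)" by (cases l) auto
    then show "des_weight P (take i l @ a # drop i l) =
        (if P (last (1 # l)) then [:0, 1:] ^ des_from 0 (take i l @ a # drop i l) else 0)"
      by (simp only: des_weight_def)
  qed
  also have "\<dots> = insertion_step (length l) (des_weight P l)"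
  proof -
    have above_or_below: "(\<forall>c\<in>set (0 # l). c < a) \<or> (\<forall>c\<in>set (0 # l). a < c)"
      using assms by (cases "a > 0") (force simp: extreme_def)+
    show ?thesis
      using sum_power_des_from_insert[OF above_or_below, of "[:0, 1:] :: real poly"]
      by (cases "P (last (1 # l))")
         (simp_all only: des_weight_def insertion_step_power insertion_step_0 sum.neutral_const
            if_True if_False)
  qed
  moreover have "des_weight P (l @ [a]) =
      (if P a then [:0, 1:] ^ of_bool (a < 0) * des_weight (\<lambda>_. True) l else 0)"
  proof -
    have "last (0 # l) \<in> insert 0 (set l)" using last_in_set[of "0 # l"] by simp
    then have "a < last (0 # l) \<longleftrightarrow> a < 0" using assms by (auto simp: extreme_def)
    then show ?thesis by (simp only: des_weight_def des_from_snoc power_add last_ConsR last_snoc) simp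
  qed
  moreover have "(\<Sum>i\<le>length l. des_weight P (take i l @ a # drop i l)) =
      (\<Sum>i<length l. des_weight P (take i l @ a # drop i l)) + des_weight P (l @ [a])"
    unfolding lessThan_Suc_atMost[symmetric] sum.lessThan_Suc by simp
  ultimately show ?thesis by (simp only:)
qed

lemma des_poly_insert:
  assumes a: "extreme a S"
  shows "des_poly P (insert a S) = insertion_step (card S) (des_poly P S) +
    (if P a then [:0, 1:] ^ of_bool (a < 0) * des_poly (\<lambda>_. True) S else 0)"
proof -
  have "des_poly P (insert a S) =
      (\<Sum>l\<in>permutations_of_set S. \<Sum>i\<le>length l. des_weight P (take i l @ a # drop i l))"
    unfolding des_poly_def using a by (intro sum_permutations_of_set_insert extreme_not_in)
  also have "\<dots> = (\<Sum>l\<in>permutations_of_set S. insertion_step (card S) (des_weight P l) +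
      (if P a then [:0, 1:] ^ of_bool (a < 0) * des_weight (\<lambda>_. True) l else 0))"
  proof (rule sum.cong[OF refl])
    fix l assume l: "l \<in> permutations_of_set S"
    then have "set l = S" by (simp add: permutations_of_set_def)
    then show "(\<Sum>i\<le>length l. des_weight P (take i l @ a # drop i l)) =
        insertion_step (card S) (des_weight P l) +
        (if P a then [:0, 1:] ^ of_bool (a < 0) * des_weight (\<lambda>_. True) l else 0)"
      using a sum_des_weight_insert[of a l P] length_finite_permutations_of_set[OF l] by simp
  qed
  finally show ?thesis
    by (simp add: sum.distrib insertion_step_sum des_poly_def sum_distrib_left)
qed

subsection \<open>Excedances\<close>

definition is_exc :: "(int \<Rightarrow> int) \<Rightarrow> int \<Rightarrow> bool" where
  "is_exc w b \<longleftrightarrow> w b > b \<or> (b < 0 \<and> w b = b)"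

definition exc_poly :: "int set \<Rightarrow> real poly" where
  "exc_poly S = (\<Sum>w | w permutes S. [:0, 1:] ^ excB S w)"

lemma excB_eq_sum: "finite S \<Longrightarrow> excB S w = (\<Sum>b\<in>S. of_bool (is_exc w b))"
  by (simp add: excB_def Int_def flip: is_exc_def)

lemma excB_insert_fixed:
  assumes "finite S" "a \<notin> S" "q permutes S"
  shows "excB (insert a S) q = excB S q + of_bool (a < 0)"
  using assms by (simp add: excB_eq_sum is_exc_def permutes_not_in del: sum_of_bool_eq)

lemma excB_insert_transpose:
  assumes S: "finite S" and a: "extreme a S" and q: "q permutes S" and c: "c \<in> S"
  shows "excB (insert a S) (transpose a (q c) \<circ> q) + of_bool (is_exc q c) = Suc (excB S q)"
proof -
  let ?w = "transpose a (q c) \<circ> q"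
  have a_notin: "a \<notin> S" using a by (rule extreme_not_in)
  have q_in: "q b \<in> S" if "b \<in> S" for b using q that by (simp add: permutes_in_image)
  have w_a_c: "?w a = q c" "?w c = a" using a_notin q by (simp_all add: permutes_not_in)
  have w_other: "is_exc ?w b = is_exc q b" if "b \<in> S - {c}" for b
  proof -
    have "q b \<noteq> q c" using that permutes_inj[OF q] by (auto dest: injD)
    moreover have "q b \<noteq> a" using that q_in a_notin by blast
    ultimately show ?thesis by (simp add: is_exc_def transpose_apply_other)
  qed
  have "of_bool (is_exc ?w a) + of_bool (is_exc ?w c) = (1 :: nat)"
    using extremeD[OF a, of c] extremeD[OF a, of "q c"] extremeD[OF a, of 0] q_in[OF c] c
    unfolding is_exc_def w_a_c by auto
  then have "excB (insert a S) ?w = Suc (\<Sum>b\<in>S - {c}. of_bool (is_exc q b))"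
    using S a_notin c by (simp add: excB_eq_sum sum.remove[OF S c] w_other del: o_apply sum_of_bool_eq)
  moreover have "excB S q = of_bool (is_exc q c) + (\<Sum>b\<in>S - {c}. of_bool (is_exc q b))"
    using S c by (simp only: excB_eq_sum sum.remove[of S c])
  ultimately show ?thesis by simp
qed

lemma sum_power_excB_insert:
  fixes x :: "'b::comm_ring_1"
  assumes S: "finite S" and a: "extreme a S" and q: "q permutes S"
  shows "(\<Sum>b\<in>S. x ^ excB (insert a S) (transpose a b \<circ> q)) =
    of_nat (excB S q) * x ^ excB S q + (of_nat (card S) - of_nat (excB S q)) * x ^ Suc (excB S q)"
proof -
  let ?e = "excB S q"
  have "(\<Sum>b\<in>S. x ^ excB (insert a S) (transpose a b \<circ> q)) =
      (\<Sum>c\<in>S. x ^ excB (insert a S) (transpose a (q c) \<circ> q))"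
    using sum.permute[OF q, of "\<lambda>b. x ^ excB (insert a S) (transpose a b \<circ> q)"] by simp
  also have "\<dots> = (\<Sum>c\<in>S. of_bool (is_exc q c) * x ^ ?e + (1 - of_bool (is_exc q c)) * x ^ Suc ?e)"
  proof (rule sum.cong[OF refl])
    fix c assume "c \<in> S"
    from excB_insert_transpose[OF S a q this]
    show "x ^ excB (insert a S) (transpose a (q c) \<circ> q) =
        of_bool (is_exc q c) * x ^ ?e + (1 - of_bool (is_exc q c)) * x ^ Suc ?e"
      by (cases "is_exc q c") (simp_all del: o_apply)
  qed
  also have "\<dots> = of_nat ?e * x ^ ?e + (of_nat (card S) - of_nat ?e) * x ^ Suc ?e"
  proof -
    have "of_nat ?e = (\<Sum>c\<in>S. of_bool (is_exc q c) :: 'b)"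
      using S by (simp only: excB_eq_sum of_nat_sum of_nat_of_bool)
    then show ?thesis
      by (simp add: sum.distrib sum_subtractf del: sum_of_bool_eq flip: sum_distrib_right)
  qed
  finally show ?thesis .
qed

lemma exc_poly_insert:
  assumes S: "finite S" and a: "extreme a S"
  shows "exc_poly (insert a S) =
    insertion_step (card S) (exc_poly S) + [:0, 1:] ^ of_bool (a < 0) * exc_poly S"
proof -
  let ?X = "[:0, 1:] :: real poly"
  have a_notin: "a \<notin> S" using a by (rule extreme_not_in)
  have "exc_poly (insert a S) =
    (\<Sum>q | q permutes S. \<Sum>b\<in>insert a S. ?X ^ excB (insert a S) (transpose a b \<circ> q))"
    unfolding exc_poly_def
    by (subst sum_over_permutations_insert[OF S a_notin]) (rule sum.swap)
  also have "\<dots> = (\<Sum>q | q permutes S. insertion_step (card S) (?X ^ excB S q) +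
      ?X ^ of_bool (a < 0) * ?X ^ excB S q)"
  proof (rule sum.cong[OF refl])
    fix q assume "q \<in> {q. q permutes S}"
    then have q: "q permutes S" by simp
    show "(\<Sum>b\<in>insert a S. ?X ^ excB (insert a S) (transpose a b \<circ> q)) =
        insertion_step (card S) (?X ^ excB S q) + ?X ^ of_bool (a < 0) * ?X ^ excB S q"
      unfolding sum.insert[OF S a_notin] insertion_step_power using S a q
      by (simp only: sum_power_excB_insert transpose_same id_o power_add
            excB_insert_fixed[OF S a_notin q])
         (simp only: add.commute mult.commute)
  qed
  finally show ?thesis
    by (simp add: sum.distrib insertion_step_sum exc_poly_def sum_distrib_left)
qed

section \<open>The type B Eulerian polynomials\<close>

definition signed_perms_on :: "nat set \<Rightarrow> (int set \<times> (int \<Rightarrow> int)) set" where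
  "signed_perms_on N = (SIGMA S:signed_sets N. {w. w permutes S})"

lemma finite_signed_perms_on: "finite N \<Longrightarrow> finite (signed_perms_on N)"
  unfolding signed_perms_on_def
  by (auto intro!: finite_SigmaI finite_signed_sets finite_permutations intro: signed_sets_finite)

lemma sum_signed_perms_on:
  assumes "finite N"
  shows "(\<Sum>p\<in>signed_perms_on N. f (fst p) (snd p)) =
    (\<Sum>S\<in>signed_sets N. \<Sum>w | w permutes S. f S w)"
proof -
  have "finite {w. w permutes S}" if "S \<in> signed_sets N" for S
    using assms that by (intro finite_permutations) (rule signed_sets_finite)
  then show ?thesis
    unfolding signed_perms_on_def using finite_signed_sets[OF assms]
    by (subst sum.Sigma) (auto simp: case_prod_beta)
qed

lemma sa_image:
  assumes "S \<in> signed_sets {1..n}"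
  shows "sa S ` {1..n} = S"
proof -
  have inj: "inj_on nat_abs S" and img: "nat_abs ` S = {1..n}"
    using assms by (auto simp: signed_sets_def)
  have "sa S (nat_abs s) = s" if "s \<in> S" for s
    using inj_onD[OF inj, of "\<bar>s\<bar>" s] that by (cases "s \<ge> 0") (auto simp: sa_def)
  then have "(\<lambda>s. sa S (nat_abs s)) ` S = S" by simp
  then show ?thesis by (simp only: image_image flip: img)
qed

lemma inj_sa: "inj (sa S)"
  by (rule injI) (auto simp: sa_def split: if_splits)

lemma signed_perms_eq: "signed_perms n = signed_perms_on {1..n}"
proof -
  have "(\<exists>a :: nat \<Rightarrow> int. (\<forall>i\<in>{1..n}. a i = int i \<or> a i = - int i) \<and> S = a ` {1..n})
      \<longleftrightarrow> S \<in> signed_sets {1..n}" (is "?L \<longleftrightarrow> ?R") for S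
  proof
    assume ?L
    then obtain a where a: "\<forall>i\<in>{1..n}. a i = int i \<or> a i = - int i" "S = a ` {1..n}" by blast
    then have "nat_abs (a i) = i" if "i \<in> {1..n}" for i using that by force
    then show ?R unfolding a(2) signed_sets_def by (auto simp: image_image intro!: inj_onI)
  next
    assume ?R
    then show ?L using sa_image[of S n] by (intro exI[of _ "sa S"]) (auto simp: sa_def)
  qed
  moreover have "bij_betw w S S \<and> (\<forall>x. x \<notin> S \<longrightarrow> w x = x) \<longleftrightarrow> w permutes S"
    for S and w :: "int \<Rightarrow> int"
    by (auto intro: bij_imp_permutes permutes_imp_bij permutes_not_in)
  ultimately show ?thesis unfolding signed_perms_def signed_perms_on_def by blast
qed

lemma bij_betw_map_permutes:
  assumes "distinct s"
  shows "bij_betw (\<lambda>w. map w s) {w. w permutes set s} (permutations_of_set (set s))"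
proof -
  have inj: "inj_on (\<lambda>w. map w s) {w. w permutes set s}"
    by (intro inj_onI) (metis map_eq_conv mem_Collect_eq permutes_not_in ext)
  have "(\<lambda>w. map w s) ` {w. w permutes set s} \<subseteq> permutations_of_set (set s)"
    using assms by (auto simp: permutes_image distinct_map permutes_inj_on)
  moreover have "card ((\<lambda>w. map w s) ` {w. w permutes set s}) = card (permutations_of_set (set s))"
    using card_permutations[OF refl, of "set s"] by (simp add: card_image[OF inj])
  ultimately show ?thesis
    using inj by (simp add: bij_betw_def card_subset_eq)
qed

lemma des_from_eq_card: "des_from b l = card {i \<in> {0..<length l}. (b # l) ! i > l ! i}"
proof -
  have "des_from b l = (\<Sum>i<length l. of_bool ((b # l) ! i > l ! i))"
    by (induction l arbitrary: b)
       (simp_all del: sum.lessThan_Suc sum_of_bool_eq add: sum.lessThan_Suc_shift)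
  then show ?thesis by (simp add: Int_def lessThan_atLeast0)
qed

lemma desB_eq_des_from: "desB n S w = des_from 0 (map (\<lambda>i. w (sa S i)) [1..<Suc n])"
proof -
  have "(0 # map (\<lambda>i. w (sa S i)) [1..<Suc n]) ! i = wval S w i" if "i < n" for i
    using that by (cases i) (simp_all add: wval_def nth_Cons' del: upt_Suc)
  then show ?thesis
    unfolding desB_def des_from_eq_card
    by (intro arg_cong[where f = card] Collect_cong)
       (auto simp: wval_def simp del: upt_Suc)
qed

lemma sum_signed_perms_eq_sum_des_poly:
  assumes "n > 0"
  shows "(\<Sum>p\<in>{p \<in> signed_perms n. P (snd p (sa (fst p) n))}. monom 1 (desB n (fst p) (snd p))) =
    (\<Sum>S\<in>signed_sets {1..n}. des_poly P S)"
proof -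
  let ?word = "\<lambda>S w. map w (map (sa S) [1..<Suc n])"
  have des_weight: "des_weight P (?word S w) =
      (if P (w (sa S n)) then monom 1 (desB n S w) else 0)" for S w
    using assms by (simp add: des_weight_def desB_eq_des_from monom_altdef o_def last_map)
  have "(\<Sum>p\<in>{p \<in> signed_perms n. P (snd p (sa (fst p) n))}. monom 1 (desB n (fst p) (snd p))) =
      (\<Sum>p\<in>signed_perms_on {1..n}. des_weight P (?word (fst p) (snd p)))"
    unfolding des_weight signed_perms_eq by (rule sum.inter_filter) (simp add: finite_signed_perms_on)
  also have "\<dots> = (\<Sum>S\<in>signed_sets {1..n}. \<Sum>w | w permutes S. des_weight P (?word S w))"
    by (rule sum_signed_perms_on) simp
  also have "\<dots> = (\<Sum>S\<in>signed_sets {1..n}. des_poly P S)"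
  proof (rule sum.cong[OF refl])
    fix S assume "S \<in> signed_sets {1..n}"
    then have "set (map (sa S) [1..<Suc n]) = S"
      using sa_image[of S n] by (simp add: atLeastLessThanSuc_atLeastAtMost del: upt_Suc)
    moreover have "distinct (map (sa S) [1..<Suc n])"
      by (simp add: distinct_map inj_on_subset[OF inj_sa] del: upt_Suc)
    ultimately have "bij_betw (?word S) {w. w permutes S} (permutations_of_set S)"
      using bij_betw_map_permutes by metis
    then show "(\<Sum>w | w permutes S. des_weight P (?word S w)) = des_poly P S"
      unfolding des_poly_def by (rule sum.reindex_bij_betw)
  qed
  finally show ?thesis .
qed

lemma des_poly_empty: "des_poly P {} = (if P 1 then 1 else 0)"
  by (simp add: des_poly_def des_weight_def)

lemma Bplus_eq_sum_des_poly: "Bplus n = (\<Sum>S\<in>signed_sets {1..n}. des_poly (\<lambda>a. a > 0) S)"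
  using sum_signed_perms_eq_sum_des_poly[of n "\<lambda>a. a > 0"]
  by (cases "n = 0") (simp_all add: Bplus_def signed_sets_empty des_poly_empty)

lemma Bminus_eq_sum_des_poly: "Bminus n = (\<Sum>S\<in>signed_sets {1..n}. des_poly (\<lambda>a. a < 0) S)"
  using sum_signed_perms_eq_sum_des_poly[of n "\<lambda>a. a < 0"]
  by (cases "n = 0") (simp_all add: Bminus_def signed_sets_empty des_poly_empty)

lemma sum_des_poly_Suc:
  "(\<Sum>S\<in>signed_sets {1..Suc n}. des_poly P S) =
    2 * insertion_step n (\<Sum>S\<in>signed_sets {1..n}. des_poly P S) +
    (of_bool (P (int (Suc n))) + of_bool (P (- int (Suc n))) * [:0, 1:]) *
      (\<Sum>S\<in>signed_sets {1..n}. des_poly (\<lambda>_. True) S)"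
proof -
  let ?m = "int (Suc n)"
  have "(\<Sum>S\<in>signed_sets {1..Suc n}. des_poly P S) =
      (\<Sum>S\<in>signed_sets {1..n}. des_poly P (insert ?m S) + des_poly P (insert (- ?m) S))"
    using sum_signed_sets_insert[of "{1..n}" "Suc n"] by (simp add: atLeastAtMostSuc_conv)
  also have "\<dots> = (\<Sum>S\<in>signed_sets {1..n}. 2 * insertion_step n (des_poly P S) +
      (of_bool (P ?m) + of_bool (P (- ?m)) * [:0, 1:]) * des_poly (\<lambda>_. True) S)"
  proof (rule sum.cong[OF refl])
    fix S assume S: "S \<in> signed_sets {1..n}"
    have "extreme ?m S" "extreme (- ?m) S"
      using extreme_signed_sets[OF S, of "Suc n"] by auto
    then show "des_poly P (insert ?m S) + des_poly P (insert (- ?m) S) =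
        2 * insertion_step n (des_poly P S) +
        (of_bool (P ?m) + of_bool (P (- ?m)) * [:0, 1:]) * des_poly (\<lambda>_. True) S"
      using signed_sets_card[OF S] by (simp add: des_poly_insert algebra_simps del: of_nat_Suc)
  qed
  finally show ?thesis
    by (simp only: sum.distrib insertion_step_sum sum_distrib_left)
qed

definition eulerianB :: "nat \<Rightarrow> real poly" where
  "eulerianB n = Bplus n + Bminus n"

lemma eulerianB_eq_sum_des_poly:
  "eulerianB n = (\<Sum>S\<in>signed_sets {1..n}. des_poly (\<lambda>_. True) S)"
  unfolding eulerianB_def Bplus_eq_sum_des_poly Bminus_eq_sum_des_poly sum.distrib[symmetric]
proof (rule sum.cong[OF refl])
  fix S assume S: "S \<in> signed_sets {1..n}"
  have "0 \<notin> S" using signed_sets_nat_abs[OF S, of 0] by auto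
  then have "last (1 # l) \<noteq> 0" if "l \<in> permutations_of_set S" for l
    using that last_in_set[of l] by (auto simp: permutations_of_set_def)
  then show "des_poly (\<lambda>a. a > 0) S + des_poly (\<lambda>a. a < 0) S = des_poly (\<lambda>_. True) S"
    unfolding des_poly_def sum.distrib[symmetric]
    by (intro sum.cong refl) (auto simp: des_weight_def simp del: last.simps)
qed

lemma Bplus_Suc: "Bplus (Suc n) = 2 * insertion_step n (Bplus n) + eulerianB n"
  using sum_des_poly_Suc[of "\<lambda>a. a > 0" n]
  by (simp add: Bplus_eq_sum_des_poly eulerianB_eq_sum_des_poly)

lemma eulerianB_0: "eulerianB 0 = 1"
  by (simp add: eulerianB_def Bplus_def Bminus_def)

lemma eulerianB_Suc:
  "eulerianB (Suc n) = 2 * insertion_step n (eulerianB n) + [:1, 1:] * eulerianB n"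
proof -
  have "1 + [:0, 1:] = [:1, 1 :: real:]" by (simp add: one_pCons)
  then show ?thesis
    using sum_des_poly_Suc[of "\<lambda>_. True" n]
    by (simp only: eulerianB_eq_sum_des_poly of_bool_eq mult_1)
qed

lemma sum_exc_poly_eq_eulerianB:
  assumes "finite N" "\<And>i. i \<in> N \<Longrightarrow> i > 0"
  shows "(\<Sum>S\<in>signed_sets N. exc_poly S) = eulerianB (card N)"
  using assms
proof (induction N rule: finite_linorder_max_induct)
  case empty
  have "exc_poly {} = 1" by (simp add: exc_poly_def excB_def)
  then show ?case by (simp add: signed_sets_empty eulerianB_0)
next
  case (insert m N)
  have "(\<Sum>S\<in>signed_sets (insert m N). exc_poly S) =
      (\<Sum>S\<in>signed_sets N. exc_poly (insert (int m) S) + exc_poly (insert (- int m) S))"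
    using insert by (intro sum_signed_sets_insert) auto
  also have "\<dots> = (\<Sum>S\<in>signed_sets N. 2 * insertion_step (card N) (exc_poly S) + [:1, 1:] * exc_poly S)"
  proof (rule sum.cong[OF refl])
    fix S assume S: "S \<in> signed_sets N"
    have "extreme (int m) S" "extreme (- int m) S"
      using extreme_signed_sets[OF S, of m] insert by auto
    moreover have "finite S" using insert.hyps(1) S by (rule signed_sets_finite)
    ultimately show "exc_poly (insert (int m) S) + exc_poly (insert (- int m) S) =
        2 * insertion_step (card N) (exc_poly S) + [:1, 1:] * exc_poly S"
      using signed_sets_card[OF S] insert.prems[of m] by (simp add: exc_poly_insert algebra_simps)
  qed
  also have "\<dots> = 2 * insertion_step (card N) (eulerianB (card N)) + [:1, 1:] * eulerianB (card N)"
    using insert.IH insert.prems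
    by (simp only: sum.distrib flip: insertion_step_sum sum_distrib_left) simp
  also have "\<dots> = eulerianB (card (insert m N))"
    using insert.hyps by (auto simp: eulerianB_Suc)
  finally show ?case .
qed

lemma fps_of_insertion_step:
  assumes "fps_of_poly p = (1 - fps_X) ^ n * F"
  shows "fps_of_poly (insertion_step n p) = (1 - fps_X) ^ Suc n * (fps_X * fps_deriv F)"
proof -
  let ?X = "fps_X :: real fps"
  have coeffs: "fps_of_poly [:0, real n:] = of_nat n * ?X"
    "fps_of_poly [:0, 1, -1 :: real:] = ?X * (1 - ?X)"
    by (simp_all add: fps_of_poly_pCons fps_of_nat algebra_simps)
  have "fps_deriv (fps_of_poly p) = (1 - ?X) ^ n * fps_deriv F - of_nat n * (1 - ?X) ^ (n - 1) * F"
    unfolding assms by (simp add: fps_deriv_power fps_of_nat algebra_simps)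
  then have "fps_of_poly (insertion_step n p) = of_nat n * ?X * ((1 - ?X) ^ n * F) +
     ?X * (1 - ?X) * ((1 - ?X) ^ n * fps_deriv F - of_nat n * (1 - ?X) ^ (n - 1) * F)"
    unfolding insertion_step_def fps_of_poly_add fps_of_poly_mult fps_of_poly_pderiv coeffs
    by (simp only: assms)
  also have "\<dots> = (1 - ?X) ^ Suc n * (?X * fps_deriv F)"
    by (cases n) (simp_all add: algebra_simps)
  finally show ?thesis .
qed

definition odd_power_fps :: "nat \<Rightarrow> real fps" where
  "odd_power_fps n = Abs_fps (\<lambda>m. (2 * real m + 1) ^ n)"

text \<open>The case distinction only matters for \<open>n = 0\<close>, where it accounts for \<open>B\<^sup>+\<^sub>0 = 1\<close>.\<close>

definition odd_even_power_fps :: "nat \<Rightarrow> real fps" where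
  "odd_even_power_fps n = Abs_fps (\<lambda>m. if m = 0 then 1 else (2 * real m + 1) ^ n - (2 * real m) ^ n)"

lemma fps_of_eulerianB: "fps_of_poly (eulerianB n) = (1 - fps_X) ^ Suc n * odd_power_fps n"
proof (induction n)
  case 0
  have "(1 - fps_X) * odd_power_fps 0 = 1"
    by (rule fps_ext) (simp add: odd_power_fps_def left_diff_distrib fps_X_mult_nth)
  then show ?case by (simp add: eulerianB_0)
next
  case (Suc n)
  let ?X = "fps_X :: real fps" and ?H = "odd_power_fps n"
  have "fps_of_poly (insertion_step n (eulerianB n)) =
      (1 - ?X) ^ Suc n * (?X * fps_deriv ((1 - ?X) * ?H))"
    using Suc by (intro fps_of_insertion_step) (simp add: mult_ac)
  then have "fps_of_poly (eulerianB (Suc n)) =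
      2 * ((1 - ?X) ^ Suc n * (?X * fps_deriv ((1 - ?X) * ?H))) + (1 + ?X) * ((1 - ?X) ^ Suc n * ?H)"
    unfolding eulerianB_Suc fps_of_poly_add fps_of_poly_mult Suc fps_of_poly_numeral
    by (simp add: fps_of_poly_pCons)
  also have "\<dots> = (1 - ?X) ^ Suc (Suc n) * (?H + 2 * ?X * fps_deriv ?H)"
    by (simp add: algebra_simps)
  also have "?H + 2 * ?X * fps_deriv ?H = odd_power_fps (Suc n)"
  proof (rule fps_ext)
    fix m
    show "fps_nth (?H + 2 * ?X * fps_deriv ?H) m = fps_nth (odd_power_fps (Suc n)) m"
      by (cases m) (simp_all add: odd_power_fps_def algebra_simps numeral_fps_const)
  qed
  finally show ?case .
qed

lemma fps_of_Bplus: "fps_of_poly (Bplus n) = (1 - fps_X) ^ n * odd_even_power_fps n"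
proof (induction n)
  case 0
  have "odd_even_power_fps 0 = 1" by (rule fps_ext) (simp add: odd_even_power_fps_def)
  then show ?case by (simp add: Bplus_def)
next
  case (Suc n)
  let ?X = "fps_X :: real fps" and ?F = "odd_even_power_fps n"
  have "fps_of_poly (Bplus (Suc n)) =
      2 * ((1 - ?X) ^ Suc n * (?X * fps_deriv ?F)) + (1 - ?X) ^ Suc n * odd_power_fps n"
    unfolding Bplus_Suc fps_of_poly_add fps_of_poly_mult fps_of_poly_numeral
      fps_of_insertion_step[OF Suc] fps_of_eulerianB ..
  also have "\<dots> = (1 - ?X) ^ Suc n * (2 * ?X * fps_deriv ?F + odd_power_fps n)"
    by (simp add: algebra_simps)
  also have "2 * ?X * fps_deriv ?F + odd_power_fps n = odd_even_power_fps (Suc n)"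
  proof (rule fps_ext)
    fix m
    show "fps_nth (2 * ?X * fps_deriv ?F + odd_power_fps n) m =
        fps_nth (odd_even_power_fps (Suc n)) m"
      by (cases m)
         (simp_all add: odd_power_fps_def odd_even_power_fps_def algebra_simps numeral_fps_const)
  qed
  finally show ?case .
qed

lemma fps_nth_binomial_conv_odd_power:
  "fps_nth (binomial_conv (\<lambda>k. of_nat c ^ k) odd_power_fps n) m = (real c + (2 * real m + 1)) ^ n"
proof -
  have "fps_nth (binomial_conv (\<lambda>k. of_nat c ^ k) odd_power_fps n) m =
      binomial_conv (\<lambda>k. real c ^ k) (\<lambda>k. (2 * real m + 1) ^ k) n"
    by (simp add: binomial_conv_def fps_sum_nth odd_power_fps_def
        mult.assoc flip: fps_of_nat)
  then show ?thesis by (simp only: binomial_conv_powers)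
qed

lemma odd_power_fps_recursion:
  "odd_power_fps n = 1 + fps_X * binomial_conv (\<lambda>k. 2 ^ k) odd_power_fps n"
proof (rule fps_ext)
  fix m
  show "fps_nth (odd_power_fps n) m =
      fps_nth (1 + fps_X * binomial_conv (\<lambda>k. 2 ^ k) odd_power_fps n) m"
    using fps_nth_binomial_conv_odd_power[of 2]
    by (cases m) (simp_all add: odd_power_fps_def algebra_simps)
qed

lemma odd_even_power_fps_recursion:
  "odd_even_power_fps n = 1 + fps_X * binomial_conv (\<lambda>k. 2 ^ k - 1) odd_power_fps n"
proof (rule fps_ext)
  fix m
  show "fps_nth (odd_even_power_fps n) m =
      fps_nth (1 + fps_X * binomial_conv (\<lambda>k. 2 ^ k - 1) odd_power_fps n) m"
    using fps_nth_binomial_conv_odd_power[of 2] fps_nth_binomial_conv_odd_power[of 1]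
    by (cases m) (simp_all add: odd_even_power_fps_def binomial_conv_diff_left algebra_simps)
qed

lemma one_minus_X_power_mult_odd_power_conv:
  "(1 - fps_X) ^ Suc n * (1 + fps_X * binomial_conv c odd_power_fps n) =
    (1 - fps_X) ^ Suc n +
    fps_X * binomial_conv (\<lambda>k. (1 - fps_X) ^ k * c k) (\<lambda>k. fps_of_poly (eulerianB k)) n"
proof -
  have "(1 - fps_X) ^ Suc n * (1 + fps_X * binomial_conv c odd_power_fps n) =
      (1 - fps_X) ^ Suc n + fps_X * ((1 - fps_X) * ((1 - fps_X) ^ n * binomial_conv c odd_power_fps n))"
    by (simp add: algebra_simps)
  then show ?thesis
    by (simp only: power_mult_binomial_conv mult_binomial_conv_right[of "1 - fps_X"] fps_of_eulerianB
        power_Suc mult.assoc)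
qed

lemma eulerianB_recursion:
  "eulerianB n = [:1, -1:] ^ Suc n + [:0, 1:] * binomial_conv (\<lambda>k. [:2, -2:] ^ k) eulerianB n"
proof -
  have "[:2, -2:] ^ k = [:1, -1 :: real:] ^ k * 2 ^ k" for k
    by (simp add: numeral_poly flip: power_mult_distrib)
  then have "fps_of_poly ([:1, -1:] ^ Suc n +
        [:0, 1:] * binomial_conv (\<lambda>k. [:2, -2:] ^ k) eulerianB n) =
      (1 - fps_X) ^ Suc n * (1 + fps_X * binomial_conv (\<lambda>k. 2 ^ k) odd_power_fps n)"
    by (simp only: one_minus_X_power_mult_odd_power_conv fps_of_poly_add fps_of_poly_mult
        fps_of_poly_power fps_of_poly_numeral fps_of_poly_binomial_conv fps_of_poly_one_minus_X fps_of_poly_fps_X)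
  also have "\<dots> = fps_of_poly (eulerianB n)"
    by (simp only: fps_of_eulerianB flip: odd_power_fps_recursion)
  finally show ?thesis by simp
qed

lemma Bplus_recursion:
  "[:1, -1:] * Bplus n = [:1, -1:] ^ Suc n +
    [:0, 1:] * binomial_conv (\<lambda>k. [:2, -2:] ^ k - [:1, -1:] ^ k) eulerianB n"
proof -
  have "[:2, -2:] ^ k - [:1, -1:] ^ k = [:1, -1 :: real:] ^ k * (2 ^ k - 1)" for k
    by (simp add: right_diff_distrib numeral_poly flip: power_mult_distrib)
  then have "fps_of_poly ([:1, -1:] ^ Suc n +
        [:0, 1:] * binomial_conv (\<lambda>k. [:2, -2:] ^ k - [:1, -1:] ^ k) eulerianB n) =
      (1 - fps_X) ^ Suc n * (1 + fps_X * binomial_conv (\<lambda>k. 2 ^ k - 1) odd_power_fps n)"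
    by (simp only: one_minus_X_power_mult_odd_power_conv fps_of_poly_add fps_of_poly_diff
        fps_of_poly_mult fps_of_poly_power fps_of_poly_numeral fps_of_poly_1 fps_of_poly_binomial_conv
        fps_of_poly_one_minus_X fps_of_poly_fps_X)
  also have "\<dots> = fps_of_poly ([:1, -1:] * Bplus n)"
    by (simp only: fps_of_poly_mult fps_of_poly_one_minus_X fps_of_Bplus mult.assoc power_Suc
        flip: odd_even_power_fps_recursion)
  finally show ?thesis by (simp only: fps_of_poly_eq_iff)
qed

lemma poly_eulerianB_recursion:
  "poly (eulerianB n) x = (1 - x) ^ Suc n +
    x * binomial_conv (\<lambda>k. (2 * (1 - x)) ^ k) (\<lambda>k. poly (eulerianB k) x) n"
  using arg_cong[OF eulerianB_recursion[of n], of "\<lambda>p. poly p x"]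
  by (simp add: poly_binomial_conv algebra_simps)

lemma poly_Bplus_recursion:
  "(1 - x) * poly (Bplus n) x = (1 - x) ^ Suc n +
    x * binomial_conv (\<lambda>k. (2 * (1 - x)) ^ k - (1 - x) ^ k) (\<lambda>k. poly (eulerianB k) x) n"
  using arg_cong[OF Bplus_recursion[of n], of "\<lambda>p. poly p x"]
  by (simp add: poly_binomial_conv algebra_simps)

section \<open>Derangements\<close>

definition derangements_on :: "nat set \<Rightarrow> (int set \<times> (int \<Rightarrow> int)) set" where
  "derangements_on N = {p \<in> signed_perms_on N. is_derangement (fst p) (snd p)}"

definition pos_fixed_points :: "int set \<Rightarrow> (int \<Rightarrow> int) \<Rightarrow> int set" where
  "pos_fixed_points S w = {a \<in> S. a > 0 \<and> w a = a}"

lemma is_derangement_iff: "is_derangement S w \<longleftrightarrow> pos_fixed_points S w = {}"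
  by (auto simp: is_derangement_def pos_fixed_points_def)

lemma excB_Diff_pos_fixed_points: "excB (S - pos_fixed_points S w) w = excB S w"
  unfolding excB_def pos_fixed_points_def by (rule arg_cong[where f = card]) auto

lemma signed_sets_Diff:
  assumes "S \<in> signed_sets N" "F \<subseteq> S"
  shows "S - F \<in> signed_sets (N - nat_abs ` F)"
  using assms inj_on_image_set_diff[of "nat_abs" S S F]
  by (auto simp: signed_sets_def inj_on_diff)

lemma signed_sets_Un_int:
  assumes "S \<in> signed_sets T" "T \<subseteq> N"
  shows "S \<union> int ` (N - T) \<in> signed_sets N"
proof -
  have "inj_on nat_abs (int ` (N - T))" by (auto intro: inj_onI)
  then have "inj_on nat_abs (S \<union> int ` (N - T))"
    using assms unfolding inj_on_Un by (auto simp: signed_sets_def)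
  then show ?thesis
    using assms by (auto simp: signed_sets_def image_Un image_image)
qed

lemma derangement_Diff_pos_fixed_points:
  assumes "(S, w) \<in> signed_perms_on N"
  shows "(S - pos_fixed_points S w, w) \<in> derangements_on (N - nat_abs ` pos_fixed_points S w)"
proof -
  have "pos_fixed_points S w \<subseteq> S" by (auto simp: pos_fixed_points_def)
  then have "S - pos_fixed_points S w \<in> signed_sets (N - nat_abs ` pos_fixed_points S w)"
    using assms by (intro signed_sets_Diff) (auto simp: signed_perms_on_def)
  moreover have "w permutes S - pos_fixed_points S w"
    using assms by (auto simp: signed_perms_on_def pos_fixed_points_def intro: permutes_superset)
  ultimately show ?thesis
    by (simp add: derangements_on_def signed_perms_on_def is_derangement_def pos_fixed_points_def)
qed

lemma signed_perm_Un_int: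
  assumes "(S, w) \<in> derangements_on T" "T \<subseteq> N" "0 \<notin> N"
  shows "(S \<union> int ` (N - T), w) \<in> signed_perms_on N"
    and "pos_fixed_points (S \<union> int ` (N - T)) w = int ` (N - T)"
    and "S \<inter> int ` (N - T) = {}"
proof -
  have S: "S \<in> signed_sets T" "w permutes S" "pos_fixed_points S w = {}"
    using assms(1) by (auto simp: derangements_on_def signed_perms_on_def is_derangement_iff)
  show disjoint: "S \<inter> int ` (N - T) = {}"
    using signed_sets_nat_abs[OF S(1)] by fastforce
  show "(S \<union> int ` (N - T), w) \<in> signed_perms_on N"
    using S assms(2) by (auto simp: signed_perms_on_def intro: signed_sets_Un_int permutes_subset)
  have "a > 0 \<and> w a = a" if "a \<in> int ` (N - T)" for a
    using that disjoint assms(3) permutes_not_in[OF S(2), of a] by (auto intro!: gr0I)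
  then show "pos_fixed_points (S \<union> int ` (N - T)) w = int ` (N - T)"
    using S(3) unfolding pos_fixed_points_def by blast
qed

text \<open>A signed permutation is determined by its positive fixed points and by the derangement that
  it induces on the other letters.\<close>

lemma sum_signed_perms_on_eq_sum_derangements:
  fixes x :: "'b::comm_semiring_1"
  assumes N: "finite N" "0 \<notin> N"
  shows "(\<Sum>p\<in>signed_perms_on N. x ^ excB (fst p) (snd p)) =
    (\<Sum>T\<in>Pow N. \<Sum>p\<in>derangements_on T. x ^ excB (fst p) (snd p))"
proof -
  have "(\<Sum>p\<in>signed_perms_on N. x ^ excB (fst p) (snd p)) =
      (\<Sum>(T, p)\<in>(SIGMA T:Pow N. derangements_on T). x ^ excB (fst p) (snd p))"
  proof (rule sum.reindex_bij_witness[where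
        i = "\<lambda>(T, S, w). (S \<union> int ` (N - T), w)" and
        j = "\<lambda>(S, w). (N - nat_abs ` pos_fixed_points S w, S - pos_fixed_points S w, w)"],
      goal_cases)
    case (1 p)
    then obtain S w where p: "p = (S, w)" "(S, w) \<in> signed_perms_on N" by (cases p) auto
    then have "nat_abs ` S = N" by (auto simp: signed_perms_on_def signed_sets_def)
    then have "nat_abs ` pos_fixed_points S w \<subseteq> N" unfolding pos_fixed_points_def by blast
    then have "N - (N - nat_abs ` pos_fixed_points S w) = nat_abs ` pos_fixed_points S w"
      by (rule double_diff[OF _ subset_refl])
    moreover have "int ` nat_abs ` pos_fixed_points S w = pos_fixed_points S w"
      by (force simp: image_image pos_fixed_points_def)
    ultimately show ?case by (auto simp: p(1) pos_fixed_points_def)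
  next
    case (2 p)
    then show ?case by (cases p) (auto intro: derangement_Diff_pos_fixed_points)
  next
    case (3 q)
    then obtain T S w where "q = (T, S, w)" "T \<subseteq> N" "(S, w) \<in> derangements_on T" by (cases q) auto
    with signed_perm_Un_int[of S w T N] N(2) show ?case
      by (auto simp: image_image Diff_Int2 double_diff)
  next
    case (4 q)
    then show ?case using signed_perm_Un_int(1) N(2) by auto
  next
    case (5 p)
    show ?case by (simp add: case_prod_beta excB_Diff_pos_fixed_points)
  qed
  moreover have "finite (derangements_on T)" if "T \<in> Pow N" for T
    using that N(1) by (auto simp: derangements_on_def intro: finite_signed_perms_on finite_subset)
  ultimately show ?thesis using N(1) by (simp add: sum.Sigma)
qed

lemma dB_eq_sum_derangements:
  "dB n = (\<Sum>p\<in>derangements_on {1..n}. [:0, 1:] ^ excB (fst p) (snd p))"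
proof (cases "n = 0")
  case True
  have "derangements_on {} = {({}, id)}"
    by (auto simp: derangements_on_def signed_perms_on_def signed_sets_empty is_derangement_def)
  then show ?thesis using True by (simp add: dB_def excB_def)
next
  case False
  then show ?thesis by (simp add: dB_def derangements_on_def signed_perms_eq monom_altdef)
qed

lemma dB_eq_binomial_transform: "dB n = binomial_transform eulerianB n"
proof -
  define d where "d T = (\<Sum>p\<in>derangements_on T. [:0, 1 :: real:] ^ excB (fst p) (snd p))" for T
  \<comment> \<open>Moebius inversion needs an identity for all finite sets; \<open>Suc\<close> keeps them free of the letter \<open>0\<close>.\<close>
  have "eulerianB (card M) = (\<Sum>T\<in>Pow M. d (Suc ` T))" if "finite M" for M
  proof -
    have "eulerianB (card M) = (\<Sum>S\<in>signed_sets (Suc ` M). exc_poly S)"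
      using that by (subst sum_exc_poly_eq_eulerianB) (auto simp: card_image)
    also have "\<dots> = (\<Sum>T\<in>Pow (Suc ` M). d T)"
      using that sum_signed_perms_on[of "Suc ` M" "\<lambda>S w. [:0, 1 :: real:] ^ excB S w"]
      by (simp add: exc_poly_def d_def flip: sum_signed_perms_on_eq_sum_derangements)
    also have "\<dots> = (\<Sum>T\<in>Pow M. d (Suc ` T))"
      unfolding image_Pow_surj[OF refl, symmetric]
      by (subst sum.reindex) (auto intro: inj_on_image_Pow)
    finally show ?thesis .
  qed
  then have "d (Suc ` {..<n}) = (\<Sum>T\<in>Pow {..<n}. (- 1) ^ (card {..<n} - card T) * eulerianB (card T))"
    by (intro inclusion_exclusion_mobius[where f = "\<lambda>T. d (Suc ` T)"]) auto
  also have "\<dots> = binomial_conv (\<lambda>k. (- 1) ^ k) eulerianB (card {..<n})"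
    by (rule sum_Pow_eq_binomial_conv) simp
  finally show ?thesis
    by (simp add: binomial_transform_def dB_eq_sum_derangements d_def image_Suc_lessThan)
qed

section \<open>Chains of intervals\<close>

definition chains_of :: "('a \<Rightarrow> 'a \<Rightarrow> bool) \<Rightarrow> 'a set \<Rightarrow> 'a set set" where
  "chains_of le X = {c. c \<subseteq> X \<and> Complete_Partial_Order.chain le c}"

definition chain_top :: "('a \<Rightarrow> 'a \<Rightarrow> bool) \<Rightarrow> 'a set \<Rightarrow> 'a" where
  "chain_top le c = (THE m. m \<in> c \<and> (\<forall>p\<in>c. le p m))"

lemma finite_chains_of: "finite X \<Longrightarrow> finite (chains_of le X)"
  by (rule finite_subset[of _ "Pow X"]) (auto simp: chains_of_def)

context
  fixes le :: "'a \<Rightarrow> 'a \<Rightarrow> bool"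
  assumes refl: "reflp le" and trans: "transp le" and antisym: "antisymp le"
begin

lemma chain_top_eqI:
  assumes "m \<in> c" "\<And>p. p \<in> c \<Longrightarrow> le p m"
  shows "chain_top le c = m"
  unfolding chain_top_def using assms antisym by (intro the_equality) (auto dest: antisympD)

lemma chain_top_greatest:
  assumes "finite c" "c \<noteq> {}" "Complete_Partial_Order.chain le c"
  shows "chain_top le c \<in> c" "\<And>p. p \<in> c \<Longrightarrow> le p (chain_top le c)"
proof -
  have "transp_on c le" using trans by (rule transp_on_subset) simp
  moreover have "totalp_on c le" using assms(3) by (auto intro: totalp_onI dest: chainD)
  ultimately obtain m where m: "m \<in> c" "\<forall>p\<in>c. p \<noteq> m \<longrightarrow> le p m"
    using Finite_Set.bex_greatest_element[OF assms(1,2)] by blast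
  then have greatest: "le p m" if "p \<in> c" for p
    using that refl by (cases "p = m") (auto dest: reflpD)
  then have "chain_top le c = m" using m(1) by (intro chain_top_eqI)
  then show "chain_top le c \<in> c" "\<And>p. p \<in> c \<Longrightarrow> le p (chain_top le c)"
    using m(1) greatest by simp_all
qed

lemma chains_of_insert_top:
  assumes "t \<in> X" "c \<in> chains_of le {p \<in> X. le p t \<and> p \<noteq> t}"
  shows "insert t c \<in> chains_of le X" "chain_top le (insert t c) = t" "t \<notin> c"
proof -
  show "insert t c \<in> chains_of le X" "t \<notin> c"
    using assms refl by (auto simp: chains_of_def chain_def reflpD)
  show "chain_top le (insert t c) = t"
    using assms(2) refl by (intro chain_top_eqI) (auto simp: chains_of_def reflpD)
qed

lemma sum_chains_by_top:
  fixes y :: "'b::comm_ring_1"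
  assumes X: "finite X"
  shows "(\<Sum>c\<in>chains_of le X. y ^ card c) =
    1 + y * (\<Sum>t\<in>X. \<Sum>c\<in>chains_of le {p \<in> X. le p t \<and> p \<noteq> t}. y ^ card c)"
proof -
  have fin: "finite c" if "c \<in> chains_of le X" for c
    using X that by (auto simp: chains_of_def intro: finite_subset)
  have top: "chain_top le c \<in> c" "\<And>p. p \<in> c \<Longrightarrow> le p (chain_top le c)"
    if "c \<in> chains_of le X - {{}}" for c
    using that fin[of c] by (auto simp: chains_of_def intro: chain_top_greatest)
  have "(\<Sum>c\<in>chains_of le X - {{}}. y ^ card c) =
    (\<Sum>(t, c)\<in>(SIGMA t:X. chains_of le {p \<in> X. le p t \<and> p \<noteq> t}). y * y ^ card c)"
  proof (rule sum.reindex_bij_witness[where i = "\<lambda>(t, c). insert t c" and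
        j = "\<lambda>c. (chain_top le c, c - {chain_top le c})"], goal_cases)
    case (1 c)
    then show ?case using top[of c] by auto
  next
    case (2 c)
    then show ?case using top[of c] by (auto simp: chains_of_def intro: chain_subset)
  next
    case (3 b)
    then show ?case using chains_of_insert_top by auto
  next
    case (4 b)
    then show ?case using chains_of_insert_top(1) by auto
  next
    case (5 c)
    then show ?case using fin[of c] top(1)[of c] card_Suc_Diff1[of c "chain_top le c"]
      by (simp flip: power_Suc)
  qed
  also have "\<dots> = y * (\<Sum>t\<in>X. \<Sum>c\<in>chains_of le {p \<in> X. le p t \<and> p \<noteq> t}. y ^ card c)"
    using X by (subst sum.Sigma[symmetric]) (auto simp: sum_distrib_left finite_chains_of)
  finally show ?thesis
    using sum.remove[of "chains_of le X" "{}" "\<lambda>c. y ^ card c"] finite_chains_of[OF X]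
    by (simp add: chains_of_def chain_empty)
qed

end

lemma int_le_order: "reflp int_le" "transp int_le" "antisymp int_le"
proof -
  show "transp int_le" unfolding transp_def int_le_def by (meson subset_trans)
qed (auto simp: int_le_def intro!: reflpI antisympI)

definition subintervals :: "nat set \<times> nat set \<Rightarrow> (nat set \<times> nat set) set" where
  "subintervals t = {p. fst p \<subseteq> snd p \<and> int_le p t}"

definition intervals_in :: "nat set \<Rightarrow> (nat set \<times> nat set) set" where
  "intervals_in F = {p. fst p \<noteq> {} \<and> fst p \<subseteq> snd p \<and> snd p \<subseteq> F}"

abbreviation interval_complex :: "nat set \<Rightarrow> (nat set \<times> nat set) set set" where
  "interval_complex F \<equiv> chains_of int_le (intervals_in F)"

lemma finite_subintervals: "finite (snd t) \<Longrightarrow> finite (subintervals t)"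
  by (rule finite_subset[of _ "Pow (snd t) \<times> Pow (snd t)"]) (auto simp: subintervals_def int_le_def)

lemma intervals_in_eq_subintervals_Diff: "intervals_in F = subintervals ({}, F) - {{}} \<times> Pow F"
  by (auto simp: intervals_in_def subintervals_def int_le_def)

lemma finite_intervals_in: "finite F \<Longrightarrow> finite (intervals_in F)"
  by (simp add: intervals_in_eq_subintervals_Diff finite_subintervals)

lemma below_interval:
  "t \<in> intervals_in F \<Longrightarrow> {p \<in> intervals_in F. int_le p t \<and> p \<noteq> t} = subintervals t - {t}"
  unfolding intervals_in_def subintervals_def int_le_def by blast

lemma below_proper_subinterval:
  assumes "t \<in> subintervals t' - {t'}"
  shows "{p \<in> subintervals t' - {t'}. int_le p t \<and> p \<noteq> t} = subintervals t - {t}"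
  using assms int_le_order by (auto simp: subintervals_def dest: transpD antisympD)

text \<open>The subintervals of \<open>[A, B]\<close> are the faces of a cube: a subset \<open>U\<close> of \<open>B - A\<close> gives the
  directions of the face, and the other coordinates are in \<open>A\<close> or outside \<open>B\<close>.\<close>

lemma sum_subintervals:
  fixes g :: "nat \<Rightarrow> 'b::comm_semiring_1"
  assumes "finite B" "A \<subseteq> B"
  shows "(\<Sum>p\<in>subintervals (A, B). g (card (snd p - fst p))) =
    binomial_conv (\<lambda>k. 2 ^ k) g (card (B - A))"
proof -
  let ?D = "B - A"
  have "(\<Sum>p\<in>subintervals (A, B). g (card (snd p - fst p))) =
     (\<Sum>(U, V)\<in>(SIGMA U:Pow ?D. Pow (?D - U)). g (card U))"
    using assms
    by (intro sum.reindex_bij_witness[where i = "\<lambda>(U, V). (A \<union> V, A \<union> V \<union> U)" and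
        j = "\<lambda>p. (snd p - fst p, fst p - A)"]) (auto simp: subintervals_def int_le_def)
  also have "\<dots> = (\<Sum>U\<in>Pow ?D. 2 ^ (card ?D - card U) * g (card U))"
    using assms
    by (subst sum.Sigma[symmetric])
       (auto simp: card_Pow card_Diff_subset finite_subset intro!: sum.cong)
  also have "\<dots> = binomial_conv (\<lambda>k. 2 ^ k) g (card ?D)"
    using assms by (intro sum_Pow_eq_binomial_conv) simp
  finally show ?thesis .
qed

lemma sum_intervals_in:
  fixes g :: "nat \<Rightarrow> 'b::comm_ring_1"
  assumes "finite F"
  shows "(\<Sum>p\<in>intervals_in F. g (card (snd p - fst p))) = binomial_conv (\<lambda>k. 2 ^ k - 1) g (card F)"
proof -
  have "(\<Sum>p\<in>{{}} \<times> Pow F. g (card (snd p - fst p))) = (\<Sum>B\<in>Pow F. 1 * g (card B))"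
    by (rule sum.reindex_bij_witness[where i = "\<lambda>B. ({}, B)" and j = snd]) auto
  also have "\<dots> = binomial_conv (\<lambda>_. 1) g (card F)"
    by (rule sum_Pow_eq_binomial_conv[OF assms])
  finally have "(\<Sum>p\<in>{{}} \<times> Pow F. g (card (snd p - fst p))) = binomial_conv (\<lambda>_. 1) g (card F)" .
  moreover have "{{}} \<times> Pow F \<subseteq> subintervals ({}, F)" by (auto simp: subintervals_def int_le_def)
  ultimately show ?thesis
    using assms
    by (simp add: intervals_in_eq_subintervals_Diff sum_diff finite_subintervals sum_subintervals binomial_conv_diff_left)
qed

definition eulerianB_quotient :: "real \<Rightarrow> nat \<Rightarrow> real" where
  "eulerianB_quotient x n = poly (eulerianB n) x / (1 - x) ^ n"

lemma eulerianB_quotient_recursion: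
  assumes "x \<noteq> 1"
  shows "eulerianB_quotient x n = 1 + x / (1 - x) *
    (binomial_conv (\<lambda>k. 2 ^ k) (eulerianB_quotient x) n - eulerianB_quotient x n)"
proof -
  have "poly (eulerianB n) x = (1 - x) ^ Suc n +
      x * binomial_conv (\<lambda>k. (1 - x) ^ k * 2 ^ k) (\<lambda>k. poly (eulerianB k) x) n"
    using poly_eulerianB_recursion[of n x, unfolded power_mult_distrib] by (simp only: mult.commute)
  then have "eulerianB_quotient x n = (1 - x) +
      x * (binomial_conv (\<lambda>k. (1 - x) ^ k * 2 ^ k) (\<lambda>k. poly (eulerianB k) x) n / (1 - x) ^ n)"
    using assms by (simp add: eulerianB_quotient_def add_divide_distrib)
  then have "eulerianB_quotient x n = (1 - x) + x * binomial_conv (\<lambda>k. 2 ^ k) (eulerianB_quotient x) n"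
    using assms by (simp add: divide_power_binomial_conv eulerianB_quotient_def[abs_def])
  then show ?thesis using assms by (simp add: field_simps)
qed

lemma Bplus_quotient_recursion:
  assumes "x \<noteq> 1"
  shows "poly (Bplus n) x / (1 - x) ^ n =
    1 + x / (1 - x) * binomial_conv (\<lambda>k. 2 ^ k - 1) (eulerianB_quotient x) n"
proof -
  have "(1 - x) * poly (Bplus n) x = (1 - x) ^ Suc n +
      x * binomial_conv (\<lambda>k. (1 - x) ^ k * (2 ^ k - 1)) (\<lambda>k. poly (eulerianB k) x) n"
    using poly_Bplus_recursion[of x n, unfolded power_mult_distrib]
    by (simp only: right_diff_distrib mult_1_right mult_1 mult.commute)
  then have "(1 - x) * (poly (Bplus n) x / (1 - x) ^ n) = (1 - x) +
      x * (binomial_conv (\<lambda>k. (1 - x) ^ k * (2 ^ k - 1)) (\<lambda>k. poly (eulerianB k) x) n / (1 - x) ^ n)"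
    using assms by (simp add: field_simps)
  then have "(1 - x) * (poly (Bplus n) x / (1 - x) ^ n) =
      (1 - x) + x * binomial_conv (\<lambda>k. 2 ^ k - 1) (eulerianB_quotient x) n"
    using assms by (simp only: divide_power_binomial_conv[of "1 - x"] eulerianB_quotient_def[abs_def])
  then show ?thesis using assms by (simp add: field_simps)
qed

lemma sum_chains_proper_subintervals:
  fixes x :: real
  assumes x: "x \<noteq> 1" and "finite B" "A \<subseteq> B"
  shows "(\<Sum>c\<in>chains_of int_le (subintervals (A, B) - {(A, B)}). (x / (1 - x)) ^ card c) =
    eulerianB_quotient x (card (B - A))"
  using assms(2,3)
proof (induction "card (B - A)" arbitrary: A B rule: less_induct)
  case less
  let ?y = "x / (1 - x)" and ?I = "subintervals (A, B)"
  let ?g = "\<lambda>p :: nat set \<times> nat set. eulerianB_quotient x (card (snd p - fst p))"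
  have fin: "finite ?I" using less.prems by (simp add: finite_subintervals)
  have "(\<Sum>c\<in>chains_of int_le (?I - {(A, B)}). ?y ^ card c) =
      1 + ?y * (\<Sum>t\<in>?I - {(A, B)}. \<Sum>c\<in>chains_of int_le (subintervals t - {t}). ?y ^ card c)"
    using fin by (subst sum_chains_by_top[OF int_le_order])
      (simp_all only: finite_Diff below_proper_subinterval cong: sum.cong)
  also have "(\<Sum>t\<in>?I - {(A, B)}. \<Sum>c\<in>chains_of int_le (subintervals t - {t}). ?y ^ card c) =
      (\<Sum>t\<in>?I - {(A, B)}. ?g t)"
  proof (rule sum.cong[OF refl])
    fix t assume t: "t \<in> ?I - {(A, B)}"
    obtain A' B' where t': "t = (A', B')" by fastforce
    have "A \<subseteq> A'" "A' \<subseteq> B'" "B' \<subseteq> B" "(A', B') \<noteq> (A, B)"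
      using t by (auto simp: t' subintervals_def int_le_def)
    then have "B' - A' \<subset> B - A" using less.prems(2) by blast
    then have "card (B' - A') < card (B - A)" using less.prems(1) by (intro psubset_card_mono) auto
    moreover have "finite B'" using \<open>B' \<subseteq> B\<close> less.prems(1) by (rule finite_subset)
    ultimately show "(\<Sum>c\<in>chains_of int_le (subintervals t - {t}). ?y ^ card c) = ?g t"
      using less.hyps \<open>A' \<subseteq> B'\<close> by (simp add: t')
  qed
  also have "\<dots> = (\<Sum>t\<in>?I. ?g t) - ?g (A, B)"
    using fin less.prems by (subst sum_diff1) (auto simp: subintervals_def int_le_def)
  also have "1 + ?y * \<dots> = eulerianB_quotient x (card (B - A))"
    using less.prems eulerianB_quotient_recursion[OF x, of "card (B - A)"]
    by (simp add: sum_subintervals)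
  finally show ?case .
qed

lemma sum_interval_complex:
  fixes x :: real
  assumes x: "x \<noteq> 1" and F: "finite F"
  shows "(\<Sum>c\<in>interval_complex F. (x / (1 - x)) ^ card c) =
    poly (Bplus (card F)) x / (1 - x) ^ card F"
proof -
  let ?y = "x / (1 - x)"
  have "(\<Sum>c\<in>interval_complex F. ?y ^ card c) =
      1 + ?y * (\<Sum>t\<in>intervals_in F. \<Sum>c\<in>chains_of int_le (subintervals t - {t}). ?y ^ card c)"
    using F by (subst sum_chains_by_top[OF int_le_order])
      (simp_all add: finite_intervals_in below_interval cong: sum.cong)
  also have "(\<Sum>t\<in>intervals_in F. \<Sum>c\<in>chains_of int_le (subintervals t - {t}). ?y ^ card c) =
      (\<Sum>t\<in>intervals_in F. eulerianB_quotient x (card (snd t - fst t)))"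
  proof (rule sum.cong[OF refl])
    fix t assume "t \<in> intervals_in F"
    then have "fst t \<subseteq> snd t" "finite (snd t)"
      using F finite_subset by (simp_all add: intervals_in_def) blast
    then show "(\<Sum>c\<in>chains_of int_le (subintervals t - {t}). ?y ^ card c) =
        eulerianB_quotient x (card (snd t - fst t))"
      using sum_chains_proper_subintervals[OF x] by (metis prod.collapse)
  qed
  also have "1 + ?y * \<dots> = poly (Bplus (card F)) x / (1 - x) ^ card F"
    by (simp only: sum_intervals_in[OF F] Bplus_quotient_recursion[OF x])
  finally show ?thesis .
qed

lemma poly_h_poly:
  fixes x :: real
  assumes fin: "finite \<Delta>" and le: "\<And>c. c \<in> \<Delta> \<Longrightarrow> card c \<le> d" and facet: "\<exists>c\<in>\<Delta>. card c = d"
    and x: "x \<noteq> 1"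
  shows "poly (h_poly \<Delta>) x = (1 - x) ^ d * (\<Sum>c\<in>\<Delta>. (x / (1 - x)) ^ card c)"
proof -
  have "Max (card ` \<Delta>) = d" using assms by (intro Max_eqI) auto
  then have "poly (h_poly \<Delta>) x = (\<Sum>c\<in>\<Delta>. x ^ card c * (1 - x) ^ (d - card c))"
    by (simp add: h_poly_def Let_def poly_sum poly_monom)
  also have "\<dots> = (\<Sum>c\<in>\<Delta>. (1 - x) ^ d * (x / (1 - x)) ^ card c)"
  proof (rule sum.cong[OF refl])
    fix c assume "c \<in> \<Delta>"
    then have "(1 - x) ^ d = (1 - x) ^ (d - card c) * (1 - x) ^ card c"
      using le by (simp flip: power_add)
    then show "x ^ card c * (1 - x) ^ (d - card c) = (1 - x) ^ d * (x / (1 - x)) ^ card c"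
      using x by (simp add: power_divide)
  qed
  finally show ?thesis by (simp add: sum_distrib_left)
qed

lemma int_le_card_eq_imp_eq:
  assumes "int_le p q" "card (snd p - fst p) = card (snd q - fst q)" "fst p \<subseteq> snd p" "fst q \<subseteq> snd q"
    and "finite (snd q)"
  shows "p = q"
proof -
  have sub: "fst q \<subseteq> fst p" "snd p \<subseteq> snd q" using assms(1) by (auto simp: int_le_def)
  then have "snd p - fst p = snd q - fst q" using assms(2,5) by (intro card_subset_eq) auto
  then have "fst p = fst q" "snd p = snd q" using sub assms(3,4) by blast+
  then show ?thesis by (simp add: prod_eq_iff)
qed

lemma interval_complex_card_le:
  assumes F: "finite F" and c: "c \<in> interval_complex F"
  shows "card c \<le> card F"
proof -
  let ?rank = "\<lambda>p :: nat set \<times> nat set. card (snd p - fst p)"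
  have interval: "fst p \<subseteq> snd p" "fst p \<noteq> {}" "snd p \<subseteq> F" if "p \<in> c" for p
    using c that unfolding chains_of_def intervals_in_def by blast+
  have "inj_on ?rank c"
  proof (rule inj_onI)
    fix p q assume pq: "p \<in> c" "q \<in> c" "?rank p = ?rank q"
    have "finite (snd p)" "finite (snd q)" using interval(3) pq F finite_subset by blast+
    moreover have "int_le p q \<or> int_le q p" using c pq by (auto simp: chains_of_def dest: chainD)
    ultimately show "p = q"
      using int_le_card_eq_imp_eq[of p q] int_le_card_eq_imp_eq[of q p] interval(1) pq by auto
  qed
  moreover have "?rank ` c \<subseteq> {..<card F}"
  proof (intro image_subsetI)
    fix p assume "p \<in> c"
    then have "snd p - fst p \<subset> F" using interval by blast
    then show "?rank p \<in> {..<card F}" using F by (simp add: psubset_card_mono)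
  qed
  ultimately show ?thesis using card_inj_on_le[of ?rank c "{..<card F}"] by simp
qed

lemma interval_complex_facet:
  assumes F: "finite F"
  shows "\<exists>c\<in>interval_complex F. card c = card F"
proof
  let ?I = "\<lambda>k. ({Min F}, {i \<in> F. i \<le> k})"
  have "inj_on ?I F" by (intro inj_onI) (auto intro!: antisym)
  then show "card (?I ` F) = card F" by (rule card_image)
  have "Complete_Partial_Order.chain int_le (?I ` F)"
  proof (rule chainI)
    fix p q assume "p \<in> ?I ` F" "q \<in> ?I ` F"
    then obtain i j where "p = ?I i" "q = ?I j" by blast
    then show "int_le p q \<or> int_le q p" by (cases "i \<le> j") (auto simp: int_le_def)
  qed
  then show "?I ` F \<in> interval_complex F"
    using F by (auto simp: chains_of_def intervals_in_def intro!: Min_in)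
qed

lemma h_poly_interval_complex:
  assumes "finite F"
  shows "h_poly (interval_complex F) = Bplus (card F)"
proof (rule poly_eqI_cofinite[of "{1}"])
  fix x :: real assume "x \<notin> {1}"
  then have x: "x \<noteq> 1" by simp
  have "poly (h_poly (interval_complex F)) x =
      (1 - x) ^ card F * (\<Sum>c\<in>interval_complex F. (x / (1 - x)) ^ card c)"
    using assms x by (intro poly_h_poly finite_chains_of finite_intervals_in interval_complex_card_le
        interval_complex_facet)
  then show "poly (h_poly (interval_complex F)) x = poly (Bplus (card F)) x"
    using x by (simp add: sum_interval_complex[OF x assms])
qed simp

lemma K_eq_interval_complex: "K n = interval_complex {1..n}"
  by (simp add: K_def chains_of_def chain_def intervals_def intervals_in_def case_prod_beta')

lemma K_carrier_eq_Union:
  assumes "G \<in> K n"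
  shows "K_carrier G = \<Union> (snd ` G)"
proof (cases "G = {}")
  case False
  have G: "G \<subseteq> intervals_in {1..n}" "Complete_Partial_Order.chain int_le G"
    using assms by (auto simp: K_eq_interval_complex chains_of_def)
  then have "finite G" by (simp add: finite_subset[OF _ finite_intervals_in])
  note top = chain_top_greatest[OF int_le_order this False G(2)]
  have "K_carrier G = snd (chain_top int_le G)" using False by (simp add: K_carrier_def chain_top_def)
  then show ?thesis using top unfolding int_le_def by blast
qed (simp add: K_carrier_def)

lemma K_restrict:
  assumes "F \<subseteq> {1..n}"
  shows "{G \<in> K n. K_carrier G \<subseteq> F} = interval_complex F"
proof -
  have "{G \<in> K n. K_carrier G \<subseteq> F} = {G \<in> K n. \<forall>p\<in>G. snd p \<subseteq> F}"
    by (intro Collect_cong conj_cong refl) (simp add: K_carrier_eq_Union UN_subset_iff)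
  also have "\<dots> = interval_complex F"
    using assms by (fastforce simp: K_eq_interval_complex chains_of_def intervals_in_def)
  finally show ?thesis .
qed

lemma local_h_K: "local_h {1..n} (K n) K_carrier = binomial_transform Bplus n"
proof -
  have "local_h {1..n} (K n) K_carrier =
      (\<Sum>F\<in>Pow {1..n}. smult ((- 1) ^ (card {1..n} - card F)) (Bplus (card F)))"
    unfolding local_h_def
    by (intro sum.cong refl) (auto simp: K_restrict h_poly_interval_complex finite_subset)
  also have "\<dots> = (\<Sum>F\<in>Pow {1..n}. (- 1) ^ (card {1..n} - card F) * Bplus (card F))"
    by (intro sum.cong refl) (simp add: minus_one_power_iff)
  also have "\<dots> = binomial_conv (\<lambda>k. (- 1) ^ k) Bplus (card {1..n})"
    by (rule sum_Pow_eq_binomial_conv) simp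
  finally show ?thesis by (simp add: binomial_transform_def)
qed

section \<open>Exponential generating functions\<close>

definition egf :: "(nat \<Rightarrow> 'a) \<Rightarrow> 'a::field_char_0 fps" where
  "egf a = Abs_fps (\<lambda>n. a n / fact n)"

lemma egf_eq_iff: "egf a = egf b \<longleftrightarrow> a = b"
  by (auto simp: egf_def fps_eq_iff fun_eq_iff)

lemma egf_power: "egf (\<lambda>n. c ^ n) = fps_exp c"
  by (simp add: egf_def fps_eq_iff)

lemma egf_add: "egf (\<lambda>n. a n + b n) = egf a + egf b"
  by (simp add: egf_def fps_eq_iff add_divide_distrib)

lemma egf_diff: "egf (\<lambda>n. a n - b n) = egf a - egf b"
  by (simp add: egf_def fps_eq_iff diff_divide_distrib)

lemma egf_mult_const: "egf (\<lambda>n. c * a n) = fps_const c * egf a"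
  by (simp add: egf_def fps_eq_iff)

lemma egf_binomial_conv: "egf (binomial_conv a b) = egf a * egf b"
proof (rule fps_ext)
  fix n
  have "binomial_conv a b n / fact n = (\<Sum>k\<le>n. b k / fact k * (a (n - k) / fact (n - k)))"
    unfolding binomial_conv_def sum_divide_distrib
    by (intro sum.cong refl) (auto simp: binomial_fact field_simps)
  then show "fps_nth (egf (binomial_conv a b)) n = fps_nth (egf a * egf b) n"
    by (simp add: egf_def fps_mult_nth atMost_atLeast0 mult.commute[of "egf a", unfolded egf_def])
qed

lemma egf_binomial_transform: "egf (binomial_transform f) = fps_exp (- 1) * egf f"
  by (simp only: binomial_transform_def egf_binomial_conv egf_power)

section \<open>Palindromic and unimodal polynomials\<close>

definition geom_poly :: "nat \<Rightarrow> 'a::comm_ring_1 poly" where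
  "geom_poly k = (\<Sum>j=1..<k. monom 1 j)"

lemma geom_poly_0 [simp]: "geom_poly 0 = 0"
  by (simp add: geom_poly_def)

lemma one_minus_X_mult_geom_poly:
  "k \<ge> 1 \<Longrightarrow> [:1, -1:] * geom_poly k = [:0, 1:] - monom 1 k"
proof (induction k rule: nat_induct_at_least)
  case base
  then show ?case by (simp add: geom_poly_def monom_altdef)
next
  case (Suc k)
  have "geom_poly (Suc k) = geom_poly k + (monom 1 k :: 'a poly)"
    using Suc.hyps by (simp add: geom_poly_def)
  then have "[:1, -1:] * geom_poly (Suc k) = [:0, 1:] - monom 1 k + [:1, -1:] * (monom 1 k :: 'a poly)"
    by (simp only: distrib_left Suc.IH)
  then show ?case by (simp add: monom_altdef)
qed

lemma poly_geom_poly: "k \<ge> 1 \<Longrightarrow> (1 - x) * poly (geom_poly k) x = x - x ^ k"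
  using arg_cong[OF one_minus_X_mult_geom_poly[of k], of "\<lambda>p. poly p x"]
  by (simp add: poly_monom algebra_simps)

definition palindromic :: "nat \<Rightarrow> 'a::field_char_0 poly \<Rightarrow> bool" where
  "palindromic n p \<longleftrightarrow> (\<forall>x. x \<noteq> 0 \<longrightarrow> poly p x = x ^ n * poly p (1 / x))"

lemma palindromicD: "palindromic n p \<Longrightarrow> x \<noteq> 0 \<Longrightarrow> x ^ n * poly p (1 / x) = poly p x"
  unfolding palindromic_def by metis

lemma palindromicI: "(\<And>x. x \<noteq> 0 \<Longrightarrow> x ^ n * poly p (1 / x) = poly p x) \<Longrightarrow> palindromic n p"
  unfolding palindromic_def by metis

lemma palindromic_0 [simp]: "palindromic n 0"
  by (simp add: palindromic_def)

lemma palindromic_add: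
  assumes "palindromic n p" "palindromic n q"
  shows "palindromic n (p + q)"
  using palindromicD[OF assms(1)] palindromicD[OF assms(2)]
  by (intro palindromicI) (simp add: distrib_left)

lemma palindromic_smult:
  assumes "palindromic n p"
  shows "palindromic n (smult c p)"
  using palindromicD[OF assms] by (intro palindromicI) (simp add: mult.left_commute)

lemma palindromic_diff:
  assumes "palindromic n p" "palindromic n q"
  shows "palindromic n (p - q)"
  using palindromic_add[OF assms(1) palindromic_smult[OF assms(2), of "- 1"]] by simp

lemma palindromic_sum:
  assumes "\<And>i. i \<in> A \<Longrightarrow> palindromic n (f i)"
  shows "palindromic n (\<Sum>i\<in>A. f i)"
  using palindromicD[OF assms] by (intro palindromicI) (simp add: poly_sum sum_distrib_left)

lemma palindromic_mult:
  assumes "palindromic m p" "palindromic n q"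
  shows "palindromic (m + n) (p * q)"
proof (rule palindromicI)
  fix x :: 'a assume x: "x \<noteq> 0"
  have "x ^ (m + n) * poly (p * q) (1 / x) = (x ^ m * poly p (1 / x)) * (x ^ n * poly q (1 / x))"
    by (simp add: power_add mult_ac)
  then show "x ^ (m + n) * poly (p * q) (1 / x) = poly (p * q) x"
    by (simp only: palindromicD[OF assms(1) x] palindromicD[OF assms(2) x] poly_mult)
qed

lemma palindromic_geom_poly: "palindromic k (geom_poly k)"
proof (rule palindromicI)
  fix x :: 'a assume x: "x \<noteq> 0"
  have "x ^ k * poly (geom_poly k) (1 / x) = (\<Sum>j=1..<k. x ^ k * (1 / x) ^ j)"
    by (simp add: geom_poly_def poly_sum poly_monom sum_distrib_left)
  also have "\<dots> = (\<Sum>j=1..<k. x ^ (k - j))"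
    using x by (intro sum.cong refl) (simp add: power_diff power_one_over)
  also have "\<dots> = (\<Sum>j=1..<k. x ^ j)"
    by (rule sum.reindex_bij_witness[of _ "\<lambda>j. k - j" "\<lambda>j. k - j"]) auto
  finally show "x ^ k * poly (geom_poly k) (1 / x) = poly (geom_poly k) x"
    by (simp add: geom_poly_def poly_sum poly_monom)
qed

lemma palindromic_coeff:
  assumes "palindromic n p"
  shows "coeff p i = (if i \<le> n then coeff p (n - i) else 0)"
proof -
  define d where "d = degree p"
  have "monom 1 d * p = monom 1 n * reflect_poly p"
  proof (rule poly_eqI_cofinite[of "{0}"])
    fix x :: 'a assume "x \<notin> {0}"
    then have x: "x \<noteq> 0" by simp
    have "poly (monom 1 n * reflect_poly p) x = x ^ d * (x ^ n * poly p (1 / x))"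
      using x by (simp add: poly_monom poly_reflect_poly_nz d_def inverse_eq_divide)
    then show "poly (monom 1 d * p) x = poly (monom 1 n * reflect_poly p) x"
      unfolding palindromicD[OF assms x] by (simp add: poly_monom)
  qed simp
  then have "coeff (monom 1 d * p) (d + i) = coeff (monom 1 n * reflect_poly p) (d + i)" by simp
  then have "coeff p i = (if d + i < n then 0 else coeff (reflect_poly p) (d + i - n))"
    by (simp add: coeff_monom_mult)
  also have "\<dots> = (if i \<le> n then coeff p (n - i) else 0)"
    by (auto simp: coeff_reflect_poly d_def coeff_eq_0)
  finally show ?thesis .
qed

lemma palindromic_Suc_imp_0:
  assumes "palindromic n p" "palindromic (Suc n) p"
  shows "p = 0"
proof (rule poly_eqI_cofinite[of "{0, 1}"])
  fix x :: 'a assume x: "x \<notin> {0, 1}"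
  then have "x * poly p x = x ^ Suc n * poly p (1 / x)"
    using palindromicD[OF assms(1), of x] by (simp add: mult.assoc)
  also have "\<dots> = poly p x" using palindromicD[OF assms(2), of x] x by simp
  finally show "poly p x = poly 0 x" using x by simp
qed simp

definition sym_unimodal :: "nat \<Rightarrow> 'a::linordered_field poly \<Rightarrow> bool" where
  "sym_unimodal n p \<longleftrightarrow> palindromic n p \<and> (\<forall>i. coeff p i \<ge> 0) \<and>
     (\<forall>i. 2 * i + 1 \<le> n \<longrightarrow> coeff p i \<le> coeff p (Suc i))"

lemma sym_unimodal_palindromic: "sym_unimodal n p \<Longrightarrow> palindromic n p"
  by (simp add: sym_unimodal_def)

lemma sym_unimodal_coeff_nonneg: "sym_unimodal n p \<Longrightarrow> coeff p i \<ge> 0"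
  by (simp add: sym_unimodal_def)

lemma sym_unimodal_coeff_mono:
  assumes p: "sym_unimodal n p" and "i \<le> j" "i + j \<le> n"
  shows "coeff p i \<le> coeff p j"
proof -
  have lower_half: "coeff p i \<le> coeff p j" if "i \<le> j" "2 * j \<le> n" for j
    using that
  proof (induction j rule: dec_induct)
    case (step j)
    then have "coeff p i \<le> coeff p j" by simp
    also have "\<dots> \<le> coeff p (Suc j)" using p step.prems by (simp add: sym_unimodal_def)
    finally show ?case .
  qed simp
  show ?thesis
  proof (cases "2 * j \<le> n")
    case False
    then have "coeff p i \<le> coeff p (n - j)" using assms(2,3) by (intro lower_half) auto
    also have "\<dots> = coeff p j"
      using palindromic_coeff[OF sym_unimodal_palindromic[OF p], of j] assms(3) by simp
    finally show ?thesis .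
  qed (use lower_half assms(2) in auto)
qed

lemma sym_unimodal_add: "sym_unimodal n p \<Longrightarrow> sym_unimodal n q \<Longrightarrow> sym_unimodal n (p + q)"
  by (auto simp: sym_unimodal_def palindromic_add intro: add_mono)

lemma sym_unimodal_smult: "c \<ge> 0 \<Longrightarrow> sym_unimodal n p \<Longrightarrow> sym_unimodal n (smult c p)"
  by (auto simp: sym_unimodal_def palindromic_smult intro: mult_left_mono)

lemma sym_unimodal_sum: "(\<And>i. i \<in> A \<Longrightarrow> sym_unimodal n (f i)) \<Longrightarrow> sym_unimodal n (\<Sum>i\<in>A. f i)"
  by (auto simp: sym_unimodal_def palindromic_sum coeff_sum intro!: sum_nonneg sum_mono)

lemma sym_unimodal_1: "sym_unimodal 0 1"
  by (simp add: sym_unimodal_def palindromic_def one_pCons coeff_pCons split: nat.split)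

lemma sym_unimodal_geom_poly_mult:
  assumes p: "sym_unimodal n p" and k: "k \<ge> 1"
  shows "sym_unimodal (k + n) (geom_poly k * p)"
  unfolding sym_unimodal_def
proof (intro conjI allI impI)
  show "palindromic (k + n) (geom_poly k * p)"
    using sym_unimodal_palindromic[OF p] palindromic_geom_poly by (intro palindromic_mult)
  have "coeff (geom_poly k) i \<ge> (0 :: 'a)" for i
    by (auto simp: geom_poly_def coeff_sum intro!: sum_nonneg)
  then show "coeff (geom_poly k * p) i \<ge> 0" for i
    using sym_unimodal_coeff_nonneg[OF p] by (auto simp: coeff_mult intro!: sum_nonneg)
  fix i assume i: "2 * i + 1 \<le> k + n"
  have "[:1, -1:] * (geom_poly k * p) = ([:0, 1:] - monom 1 k) * p"
    by (simp only: mult.assoc[symmetric] one_minus_X_mult_geom_poly[OF k])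
  then have "coeff ([:1, -1:] * (geom_poly k * p)) (Suc i) =
      coeff (([:0, 1:] - monom 1 k) * p) (Suc i)"
    by simp
  then have "coeff (geom_poly k * p) (Suc i) - coeff (geom_poly k * p) i =
      coeff p i - (if Suc i < k then 0 else coeff p (Suc i - k))"
    by (simp add: left_diff_distrib coeff_monom_mult)
  moreover have "coeff p (Suc i - k) \<le> coeff p i" if "k \<le> Suc i"
    using that i k by (intro sym_unimodal_coeff_mono[OF p]) auto
  ultimately show "coeff (geom_poly k * p) i \<le> coeff (geom_poly k * p) (Suc i)"
    using sym_unimodal_coeff_nonneg[OF p, of i] by (auto split: if_splits)
qed

lemma sym_unimodal_imp_unimodal_upto:
  assumes p: "sym_unimodal n p"
  shows "unimodal_upto p n"
  unfolding unimodal_upto_def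
proof (intro exI[of _ "n div 2"] conjI allI impI)
  fix i assume "i < n div 2"
  then show "coeff p i \<le> coeff p (Suc i)" by (intro sym_unimodal_coeff_mono[OF p]) auto
next
  fix i assume i: "n div 2 \<le> i \<and> i < n"
  note reflect = palindromic_coeff[OF sym_unimodal_palindromic[OF p]]
  have "coeff p (n - Suc i) \<le> coeff p (n - i)"
    using i by (intro sym_unimodal_coeff_mono[OF p]) auto
  then show "coeff p (Suc i) \<le> coeff p i" using i reflect[of i] reflect[of "Suc i"] by simp
qed simp

section \<open>The binomial transforms of the descent polynomials\<close>

lemma egf_eulerianB:
  "(1 - fps_const x * fps_exp (2 * (1 - x))) * egf (\<lambda>n. poly (eulerianB n) x) =
    fps_const (1 - x) * fps_exp (1 - x)"
proof -
  have "egf (\<lambda>n. poly (eulerianB n) x) = fps_const (1 - x) * fps_exp (1 - x) +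
      fps_const x * (fps_exp (2 * (1 - x)) * egf (\<lambda>n. poly (eulerianB n) x))"
    by (subst poly_eulerianB_recursion)
       (simp only: power_Suc egf_add egf_mult_const egf_power egf_binomial_conv)
  then show ?thesis by (simp add: algebra_simps)
qed

lemma egf_Bplus:
  assumes "x \<noteq> 1"
  shows "(1 - fps_const x * fps_exp (2 * (1 - x))) * egf (\<lambda>n. poly (Bplus n) x) =
    fps_exp (1 - x) - fps_const x * fps_exp (2 * (1 - x))"
proof -
  let ?c = "fps_const x" and ?u = "fps_const (1 - x)" and ?E = "fps_exp (1 - x)"
    and ?E2 = "fps_exp (2 * (1 - x))"
  let ?B = "egf (\<lambda>n. poly (eulerianB n) x)" and ?P = "egf (\<lambda>n. poly (Bplus n) x)"
  have exp_square: "?E2 = ?E * ?E" by (simp flip: fps_exp_add_mult)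
  have const_eq: "?u = 1 - ?c" by (simp flip: fps_const_sub)
  have Bplus_eq: "?u * ?P = ?u * ?E + ?c * ((?E2 - ?E) * ?B)"
    unfolding egf_mult_const[symmetric] poly_Bplus_recursion
    by (simp only: power_Suc egf_add egf_mult_const egf_power egf_diff egf_binomial_conv)
  have "?u * ((1 - ?c * ?E2) * ?P) = (1 - ?c * ?E2) * (?u * ?P)"
    by (rule mult.left_commute)
  also have "\<dots> = (1 - ?c * ?E2) * (?u * ?E) + ?c * (?E2 - ?E) * ((1 - ?c * ?E2) * ?B)"
    unfolding Bplus_eq by (simp add: algebra_simps)
  also have "\<dots> = ?u * (?E - ?c * ?E2)"
    unfolding egf_eulerianB unfolding exp_square const_eq by (simp add: algebra_simps)
  finally show ?thesis using assms by simp
qed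

lemma egf_Bminus:
  assumes "x \<noteq> 1"
  shows "(1 - fps_const x * fps_exp (2 * (1 - x))) * egf (\<lambda>n. poly (Bminus n) x) =
    fps_const x * (fps_exp (2 * (1 - x)) - fps_exp (1 - x))"
proof -
  let ?k = "1 - fps_const x * fps_exp (2 * (1 - x))"
  have "egf (\<lambda>n. poly (Bminus n) x) = egf (\<lambda>n. poly (eulerianB n) x) - egf (\<lambda>n. poly (Bplus n) x)"
    unfolding egf_diff[symmetric] by (simp add: eulerianB_def)
  then have "?k * egf (\<lambda>n. poly (Bminus n) x) =
      ?k * egf (\<lambda>n. poly (eulerianB n) x) - ?k * egf (\<lambda>n. poly (Bplus n) x)"
    by (simp only: right_diff_distrib[of ?k])
  also have "\<dots> = fps_const (1 - x) * fps_exp (1 - x) -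
      (fps_exp (1 - x) - fps_const x * fps_exp (2 * (1 - x)))"
    by (simp only: egf_eulerianB egf_Bplus[OF assms])
  also have "\<dots> = fps_const x * (fps_exp (2 * (1 - x)) - fps_exp (1 - x))"
    by (simp add: algebra_simps flip: fps_const_sub)
  finally show ?thesis .
qed

definition egf_denominator :: "'a::field_char_0 \<Rightarrow> 'a fps" where
  "egf_denominator x = fps_exp (2 * x) - fps_const x * fps_exp 2"

lemma egf_denominator_mult_binomial_transform:
  assumes "(1 - fps_const x * fps_exp (2 * (1 - x))) * egf (\<lambda>n. poly (f n) x) = r"
  shows "egf_denominator x * egf (\<lambda>n. poly (binomial_transform f n) x) =
    fps_exp (2 * x - 1) * r"
proof -
  have "egf_denominator x = fps_exp (2 * x) * (1 - fps_const x * fps_exp (2 * (1 - x)))"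
    by (simp add: egf_denominator_def right_diff_distrib mult.left_commute flip: fps_exp_add_mult)
  then have "egf_denominator x * egf (\<lambda>n. poly (binomial_transform f n) x) =
      (fps_exp (2 * x) * fps_exp (- 1)) *
        ((1 - fps_const x * fps_exp (2 * (1 - x))) * egf (\<lambda>n. poly (f n) x))"
    by (simp only: poly_binomial_transform egf_binomial_transform mult_ac)
  also have "fps_exp (2 * x) * fps_exp (- 1) = fps_exp (2 * x - 1)" by (simp flip: fps_exp_add_mult)
  finally show ?thesis unfolding assms .
qed

text \<open>Dividing by \<open>1 - x\<close> turns the coefficients \<open>2\<^sup>k (x - x\<^sup>k)\<close> read off from the denominator into
  polynomials with nonnegative coefficients.\<close>

lemma recursion_from_egf_denominator:
  fixes a s :: "nat \<Rightarrow> real poly"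
  assumes "\<And>x. x \<noteq> 1 \<Longrightarrow> egf_denominator x * egf (\<lambda>n. poly (a n) x) =
    egf (\<lambda>n. (1 - x) * poly (s n) x)"
  shows "a n = s n + binomial_conv (\<lambda>k. smult (2 ^ k) (geom_poly k)) a n"
proof (rule poly_eqI_cofinite[of "{1}"])
  fix x :: real assume "x \<notin> {1}"
  then have x: "x \<noteq> 1" by simp
  have kernel: "(2 * x) ^ k - x * 2 ^ k =
      (1 - x) * (of_bool (k = 0) - 2 ^ k * poly (geom_poly k) x)" for k
  proof (cases "k = 0")
    case False
    then have "(1 - x) * poly (geom_poly k) x = x - x ^ k" by (intro poly_geom_poly) simp
    then have "2 ^ k * ((1 - x) * poly (geom_poly k) x) = 2 ^ k * (x - x ^ k)" by simp
    then show ?thesis using False by (simp add: power_mult_distrib algebra_simps)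
  qed simp
  have "egf (\<lambda>n. (1 - x) * poly (s n) x) =
      egf (binomial_conv (\<lambda>k. (2 * x) ^ k - x * 2 ^ k) (\<lambda>n. poly (a n) x))"
    using assms[OF x]
    by (simp only: egf_denominator_def egf_binomial_conv egf_diff egf_mult_const egf_power)
  then have "(1 - x) * poly (s n) x =
      binomial_conv (\<lambda>k. (2 * x) ^ k - x * 2 ^ k) (\<lambda>n. poly (a n) x) n"
    by (simp add: egf_eq_iff fun_eq_iff)
  also have "\<dots> = (1 - x) * (poly (a n) x -
      binomial_conv (\<lambda>k. 2 ^ k * poly (geom_poly k) x) (\<lambda>n. poly (a n) x) n)"
    unfolding kernel
    by (simp only: binomial_conv_diff_left binomial_conv_delta_left flip: mult_binomial_conv_left)
  finally have "poly (s n) x = poly (a n) x -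
      binomial_conv (\<lambda>k. 2 ^ k * poly (geom_poly k) x) (\<lambda>n. poly (a n) x) n"
    using x by simp
  then show "poly (a n) x = poly (s n + binomial_conv (\<lambda>k. smult (2 ^ k) (geom_poly k)) a n) x"
    by (simp add: poly_binomial_conv)
qed simp

lemma binomial_transform_Bplus_recursion:
  "binomial_transform Bplus n = of_bool (n = 0) - geom_poly n +
    binomial_conv (\<lambda>k. smult (2 ^ k) (geom_poly k)) (binomial_transform Bplus) n"
proof (rule recursion_from_egf_denominator)
  fix x :: real assume x: "x \<noteq> 1"
  have "x ^ n - x * 1 ^ n = (1 - x) * poly (of_bool (n = 0) - geom_poly n) x" for n
    using poly_geom_poly[of n x] by (cases "n = 0") (simp_all add: right_diff_distrib)
  then have "egf (\<lambda>n. (1 - x) * poly (of_bool (n = 0) - geom_poly n) x) =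
      fps_exp x - fps_const x * fps_exp 1"
    unfolding egf_power[symmetric] egf_mult_const[symmetric] egf_diff[symmetric] by simp
  also have "\<dots> = fps_exp (2 * x - 1) * (fps_exp (1 - x) - fps_const x * fps_exp (2 * (1 - x)))"
    by (simp add: right_diff_distrib mult.left_commute flip: fps_exp_add_mult)
  finally show "egf_denominator x * egf (\<lambda>n. poly (binomial_transform Bplus n) x) =
      egf (\<lambda>n. (1 - x) * poly (of_bool (n = 0) - geom_poly n) x)"
    using egf_denominator_mult_binomial_transform[OF egf_Bplus[OF x]] by simp
qed

lemma binomial_transform_Bminus_recursion:
  "binomial_transform Bminus n = geom_poly (Suc n) +
    binomial_conv (\<lambda>k. smult (2 ^ k) (geom_poly k)) (binomial_transform Bminus) n"
proof (rule recursion_from_egf_denominator)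
  fix x :: real assume x: "x \<noteq> 1"
  have "x * (1 ^ n - x ^ n) = (1 - x) * poly (geom_poly (Suc n)) x" for n
    using poly_geom_poly[of "Suc n" x] by (simp add: right_diff_distrib)
  then have "egf (\<lambda>n. (1 - x) * poly (geom_poly (Suc n)) x) = fps_const x * (fps_exp 1 - fps_exp x)"
    unfolding egf_power[symmetric] egf_diff[symmetric] egf_mult_const[symmetric] by simp
  also have "\<dots> = fps_exp (2 * x - 1) * (fps_const x * (fps_exp (2 * (1 - x)) - fps_exp (1 - x)))"
    by (simp add: right_diff_distrib mult.left_commute flip: fps_exp_add_mult)
  finally show "egf_denominator x * egf (\<lambda>n. poly (binomial_transform Bminus n) x) =
      egf (\<lambda>n. (1 - x) * poly (geom_poly (Suc n)) x)"
    using egf_denominator_mult_binomial_transform[OF egf_Bminus[OF x]] by simp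
qed

lemma sym_unimodal_binomial_transform_Bplus: "sym_unimodal n (binomial_transform Bplus n)"
proof (induction n rule: less_induct)
  case (less n)
  let ?P = "binomial_transform Bplus"
  have P_0: "?P 0 = 1" by (simp add: binomial_transform_def binomial_conv_def Bplus_def)
  show ?case
  proof (cases "n = 0")
    case True
    then show ?thesis using sym_unimodal_1 by (simp add: P_0)
  next
    case False
    let ?term = "\<lambda>k. smult (2 ^ (n - k) * real (n choose k)) (geom_poly (n - k) * ?P k)"
    have "binomial_conv (\<lambda>k. smult (2 ^ k) (geom_poly k)) ?P n = (\<Sum>k\<le>n. ?term k)"
      by (simp add: binomial_conv_def of_nat_poly)
    also have "\<dots> = ?term 0 + (\<Sum>k\<in>{1..<n}. ?term k)"
    proof -
      have "{..n} = {0} \<union> {1..<n} \<union> {n}" by auto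
      then show ?thesis using False by simp
    qed
    finally have "?P n = smult (2 ^ n - 1) (geom_poly n) + (\<Sum>k\<in>{1..<n}. ?term k)"
      using False by (subst binomial_transform_Bplus_recursion) (simp add: P_0 smult_diff_left)
    moreover have "sym_unimodal n (geom_poly n :: real poly)"
      using sym_unimodal_geom_poly_mult[OF sym_unimodal_1, of n] False by simp
    moreover have "sym_unimodal n (geom_poly (n - k) * ?P k)" if "k \<in> {1..<n}" for k
      using sym_unimodal_geom_poly_mult[OF less[of k], of "n - k"] that by (simp add: Suc_le_eq)
    ultimately show ?thesis
      by (auto intro!: sym_unimodal_add sym_unimodal_smult sym_unimodal_sum)
  qed
qed

lemma palindromic_binomial_transform_Bminus: "palindromic (Suc n) (binomial_transform Bminus n)"
proof (induction n rule: less_induct)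
  case (less n)
  let ?M = "binomial_transform Bminus"
  have "palindromic (Suc n) (geom_poly (n - k) * ?M k)" if "k \<le> n" for k
    using palindromic_mult[OF palindromic_geom_poly[of "n - k"] less[of k]] that
    by (cases "k = n") simp_all
  then have "palindromic (Suc n) (binomial_conv (\<lambda>k. smult (2 ^ k) (geom_poly k)) ?M n)"
    by (auto simp: binomial_conv_def of_nat_poly intro!: palindromic_sum palindromic_smult)
  then show ?case
    by (subst binomial_transform_Bminus_recursion) (intro palindromic_add palindromic_geom_poly)
qed

lemma fpm_decomp_iff:
  "fpm_decomp n p q \<longleftrightarrow> p = binomial_transform Bplus n \<and> q = binomial_transform Bminus n"
proof -
  let ?P = "binomial_transform Bplus n" and ?M = "binomial_transform Bminus n"
  have decomp: "fpm_decomp n p q \<longleftrightarrow> ?P + ?M = p + q \<and> palindromic n p \<and> palindromic (Suc n) q" for p q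
    unfolding fpm_decomp_def palindromic_def dB_eq_binomial_transform binomial_transform_def
    by (simp add: eulerianB_def[abs_def] binomial_conv_add_right)
  have P: "palindromic n ?P"
    by (intro sym_unimodal_palindromic sym_unimodal_binomial_transform_Bplus)
  note M = palindromic_binomial_transform_Bminus[of n]
  show ?thesis
  proof
    assume "fpm_decomp n p q"
    then have pq: "?P + ?M = p + q" "palindromic n p" "palindromic (Suc n) q"
      by (simp_all add: decomp)
    have diff_eq: "p - ?P = ?M - q" using pq(1) by (simp add: algebra_simps)
    have "p - ?P = 0"
    proof (rule palindromic_Suc_imp_0)
      show "palindromic n (p - ?P)" using pq P by (intro palindromic_diff)
      show "palindromic (Suc n) (p - ?P)" unfolding diff_eq using pq M by (intro palindromic_diff)
    qed
    then show "p = ?P \<and> q = ?M" using diff_eq by simp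
  qed (use P M in \<open>simp add: decomp\<close>)
qed

lemma fplus_fminus_eq:
  "fplus n = binomial_transform Bplus n" "fminus n = binomial_transform Bminus n"
proof -
  have "(THE pq. fpm_decomp n (fst pq) (snd pq)) =
      (binomial_transform Bplus n, binomial_transform Bminus n)"
    by (rule the_equality) (auto simp: fpm_decomp_iff prod_eq_iff)
  then show "fplus n = binomial_transform Bplus n" "fminus n = binomial_transform Bminus n"
    by (simp_all add: fplus_def fminus_def)
qed

theorem theorem1p3:
  shows "(\<forall>n\<ge>1. fplus n = local_h {1..n} (K n) K_carrier \<and>
            (\<forall>i. coeff (fplus n) i \<ge> 0) \<and>
            (\<forall>i\<le>n. coeff (fplus n) i = coeff (fplus n) (n - i)) \<and>
            unimodal_upto (fplus n) n) \<and>
         (\<forall>n. fplus n = (\<Sum>k=0..n. smult ((-1) ^ (n - k) * real (n choose k)) (Bplus k)) \<and>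
              fminus n = (\<Sum>k=0..n. smult ((-1) ^ (n - k) * real (n choose k)) (Bminus k)))"
proof (intro conjI allI impI)
  fix n i :: nat
  have sym: "sym_unimodal n (fplus n)"
    unfolding fplus_fminus_eq by (rule sym_unimodal_binomial_transform_Bplus)
  show "fplus n = local_h {1..n} (K n) K_carrier"
    by (simp only: fplus_fminus_eq local_h_K)
  show "coeff (fplus n) i \<ge> 0" using sym by (rule sym_unimodal_coeff_nonneg)
  show "coeff (fplus n) i = coeff (fplus n) (n - i)" if "i \<le> n"
    using palindromic_coeff[OF sym_unimodal_palindromic[OF sym], of i] that by simp
  show "unimodal_upto (fplus n) n" using sym by (rule sym_unimodal_imp_unimodal_upto)
  show "fplus n = (\<Sum>k=0..n. smult ((-1) ^ (n - k) * real (n choose k)) (Bplus k))"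
    "fminus n = (\<Sum>k=0..n. smult ((-1) ^ (n - k) * real (n choose k)) (Bminus k))"
    by (simp_all only: fplus_fminus_eq binomial_transform_eq_sum_smult)
qed

end
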